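(* Let $n\ge 2$ and $1\leq p\leq n-1$. Then for Lebesgue almost every pair $(\mathbf{x},\mathbf{y})\in \mathbb{R}^{(n,p)} \times \mathbb{R}^{(n,p)}$ the exponent of approximation satisfies $$e(\mathbf{x}, \mathbf{y}) =\frac{n-p}{p}.$$
   Context: $\Gamma$ is the multiplicative semigroup of all $n\times n$ matrices with integer entries and positive determinant. $\mathbb{R}^{(n,p)}=\mathbb{R}^n\oplus\cdots\oplus\mathbb{R}^n$ ($p$ copies), i.e. $p$-tuples of column vectors in $\mathbb{R}^n$ (equivalently real $n\times p$ matrices), and $\gamma\in\Gamma$ acts by $\gamma(x_1,\dots,x_p)=(\gamma x_1,\dots,\gamma x_p)$. The norm $\|\cdot\|$ of an element of $\mathbb{R}^{(n,p)}$ or of an $n\times n$ matrix is the maximum of the absolute values of its entries. For $\mathbf{x},\mathbf{y}\in\mathbb{R}^{(n,p)}$ the exponent of approximation of the action of $\Gamma$ corresponding to the pair $(\mathbf{x},\mathbf{y})$ is $$e(\mathbf{x},\mathbf{y})=\sup\left\{\mu\in\mathbb{R}\;\middle|\; \|\gamma\mathbf{x}-\mathbf{y}\|<\frac{1}{\|\gamma\|^{\mu}}\ \text{for infinitely many } \gamma\in\Gamma\right\}.$$ *)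

theory Defs
  imports "HOL-Analysis.Analysis"
begin

text \<open>Real \<open>n \<times> p\<close> matrices have type \<open>real ^ 'p ^ 'n\<close>: entry \<open>x $ i $ j\<close> is the \<open>i\<close>-th
  coordinate of the \<open>j\<close>-th column vector \<open>x\<^sub>j\<close>, so that \<open>\<gamma> ** x\<close> is the matrix whose
  columns are the vectors \<open>\<gamma> *v x\<^sub>j\<close>.\<close>

text \<open>This is not the library's Euclidean \<open>norm\<close> on these types.\<close>

definition max_norm :: "real ^ 'c ^ 'r \<Rightarrow> real" where
  "max_norm A = Max {\<bar>A $ i $ j\<bar> | i j. True}"

definition Gamma_semigroup :: "(real ^ 'n ^ 'n) set" where
  "Gamma_semigroup = {\<gamma>. (\<forall>i j. \<gamma> $ i $ j \<in> \<int>) \<and> det \<gamma> > 0}"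

text \<open>The supremum is taken in the extended reals, since the set of admissible exponents need
  not be bounded. Matrices in \<open>Gamma_semigroup\<close> have \<open>max_norm\<close> at least 1, so \<open>powr\<close> is
  always applied to a positive base.\<close>

definition approx_exponent :: "real ^ 'p ^ 'n \<Rightarrow> real ^ 'p ^ 'n \<Rightarrow> ereal" where
  "approx_exponent x y =
     Sup {ereal \<mu> | \<mu>.
       infinite {\<gamma> \<in> Gamma_semigroup. max_norm (\<gamma> ** x - y) < 1 / max_norm \<gamma> powr \<mu>}}"

end

theory Submission
  imports
    Defs
    "HOL-Probability.Probability"
    "HOL-Computational_Algebra.Polynomial"
    "HOL-Real_Asymp.Real_Asymp"
begin

text \<open>
  Pick \<open>p\<close> of the \<open>n\<close> rows of \<open>x\<close>. Generically they form an invertible block \<open>w\<close>, and replacing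
  \<open>(x, y)\<close> by \<open>(x w\<^sup>-\<^sup>1, y w\<^sup>-\<^sup>1)\<close> does not change the exponent, so the block may be taken to be the
  identity. The entries of \<open>\<gamma>\<close> in the corresponding \<open>p\<close> columns are then just integer parts, and row
  \<open>i\<close> of \<open>\<gamma> x - y\<close> can be made small iff \<open>q x' - y\<^sub>i\<close> is small modulo \<open>\<int>\<^sup>p\<close>, where
  \<open>q \<in> \<int>\<^sup>n\<^sup>-\<^sup>p\<close> consists of the remaining entries of that row and \<open>x'\<close> of the remaining rows of \<open>x\<close>.

  For random \<open>(x, y)\<close> the points \<open>q x' - y\<^sub>i\<close> are uniformly distributed on the torus and pairwise
  independent for distinct \<open>q\<close>. With \<open>T\<^sup>n\<^sup>-\<^sup>p\<close> choices of \<open>q\<close> and a target of volume \<open>T\<^sup>-\<^sup>\<mu>\<^sup>p\<close>, the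
  first moment method bounds the exponent above by \<open>(n - p) / p\<close> and the second moment method bounds
  it below, both via Borel-Cantelli along \<open>T = 2\<^sup>k\<close>. Since the second moment method works for \<open>q\<close> in
  any box of side \<open>T\<close>, one may place the box around a large multiple of a prescribed integer
  matrix; this forces the sign of the determinant of \<open>\<gamma>\<close>.
\<close>

section \<open>Measure on tori\<close>

definition unit_cube :: "'a::euclidean_space set" where
  "unit_cube = {x. \<forall>b\<in>Basis. 0 \<le> x \<bullet> b \<and> x \<bullet> b < 1}"

definition integer_points :: "'a::euclidean_space set" where
  "integer_points = {x. \<forall>b\<in>Basis. x \<bullet> b \<in> \<int>}"

text \<open>Such sets are the preimages of subsets of the torus;
  \<open>emeasure lborel (unit_cube \<inter> A)\<close> is then the Haar measure of the
  subset.\<close>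

definition lattice_periodic :: "'a::euclidean_space set \<Rightarrow> bool" where
  "lattice_periodic A \<longleftrightarrow> (\<forall>z\<in>integer_points. \<forall>x\<in>A. x + z \<in> A)"

lemma unit_cube_borel [measurable]: "unit_cube \<in> sets borel"
  unfolding unit_cube_def by measurable

lemma integer_points_uminus: "z \<in> integer_points \<Longrightarrow> - z \<in> integer_points"
  unfolding integer_points_def by auto

lemma lattice_periodic_iff:
  assumes "lattice_periodic A" and "z \<in> integer_points"
  shows "x + z \<in> A \<longleftrightarrow> x \<in> A"
proof
  assume "x + z \<in> A"
  then have "x + z + (- z) \<in> A"
    using assms integer_points_uminus unfolding lattice_periodic_def by blast
  then show "x \<in> A" by simp
qed (use assms in \<open>auto simp: lattice_periodic_def\<close>)

lemma countable_integer_points: "countable (integer_points :: 'a::euclidean_space set)"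
proof -
  have "(integer_points :: 'a set) \<subseteq> (\<lambda>f. \<Sum>b\<in>Basis. real_of_int (f b) *\<^sub>R b) ` (Basis \<rightarrow>\<^sub>E UNIV)"
  proof
    fix x :: 'a assume x: "x \<in> integer_points"
    have "x = (\<Sum>b\<in>Basis. real_of_int (restrict (\<lambda>b. \<lfloor>x \<bullet> b\<rfloor>) Basis b) *\<^sub>R b)"
      using x by (subst euclidean_representation [of x, symmetric])
        (auto simp: integer_points_def intro!: sum.cong)
    then show "x \<in> (\<lambda>f. \<Sum>b\<in>Basis. real_of_int (f b) *\<^sub>R b) ` (Basis \<rightarrow>\<^sub>E UNIV)"
      by (rule image_eqI [where f = "\<lambda>f. \<Sum>b\<in>Basis. real_of_int (f b) *\<^sub>R b"]) auto
  qed
  then show ?thesis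
    by (rule countable_subset) (intro countable_image countable_PiE, auto)
qed

lemma unit_cube_translate_iff:
  fixes x z :: "'a::euclidean_space"
  assumes "z \<in> integer_points"
  shows "x + z \<in> unit_cube \<longleftrightarrow> z = - (\<Sum>b\<in>Basis. of_int \<lfloor>x \<bullet> b\<rfloor> *\<^sub>R b)"
proof -
  have "0 \<le> x \<bullet> b + z \<bullet> b \<and> x \<bullet> b + z \<bullet> b < 1 \<longleftrightarrow> z \<bullet> b = - of_int \<lfloor>x \<bullet> b\<rfloor>"
    if b: "b \<in> Basis" for b
  proof -
    obtain k where k: "z \<bullet> b = of_int k"
      using assms b unfolding integer_points_def Ints_def by auto
    have "k = - \<lfloor>x \<bullet> b\<rfloor> \<longleftrightarrow> \<lfloor>x \<bullet> b\<rfloor> = - k" by linarith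
    also have "\<dots> \<longleftrightarrow> 0 \<le> x \<bullet> b + of_int k \<and> x \<bullet> b + of_int k < 1"
      by (auto simp: floor_eq_iff)
    finally show ?thesis unfolding k by (metis of_int_eq_iff of_int_minus)
  qed
  then have "x + z \<in> unit_cube \<longleftrightarrow> (\<forall>b\<in>Basis. z \<bullet> b = - of_int \<lfloor>x \<bullet> b\<rfloor>)"
    unfolding unit_cube_def by (auto simp: inner_add_left)
  also have "\<dots> \<longleftrightarrow> (\<forall>b\<in>Basis. z \<bullet> b = (- (\<Sum>b\<in>Basis. of_int \<lfloor>x \<bullet> b\<rfloor> *\<^sub>R b)) \<bullet> b)"
    by (simp add: inner_sum_left_Basis)
  finally show ?thesis by (simp add: euclidean_eq_iff [of z])
qed

lemma floor_vector_integer: "- (\<Sum>b\<in>Basis. of_int \<lfloor>x \<bullet> b\<rfloor> *\<^sub>R b) \<in> integer_points"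
  unfolding integer_points_def by (auto simp: inner_sum_left_Basis)

lemma emeasure_unit_cube: "emeasure lborel (unit_cube :: 'a::euclidean_space set) = 1"
proof (rule antisym)
  have "emeasure lborel (unit_cube :: 'a set) \<le> emeasure lborel (cbox 0 One :: 'a set)"
    by (intro emeasure_mono) (auto simp: unit_cube_def mem_box less_imp_le)
  then show "emeasure lborel (unit_cube :: 'a set) \<le> 1"
    by (simp add: emeasure_lborel_cbox_eq)
  have "emeasure lborel (box 0 One :: 'a set) \<le> emeasure lborel (unit_cube :: 'a set)"
    by (intro emeasure_mono) (auto simp: unit_cube_def mem_box less_imp_le)
  then show "1 \<le> emeasure lborel (unit_cube :: 'a set)"
    by (simp add: emeasure_lborel_box_eq)
qed

text \<open>The half-open cube is a fundamental domain of the lattice, so exactly one summand is 1.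
  The sum serves as a partition of unity.\<close>

lemma nn_integral_integer_translates:
  "(\<integral>\<^sup>+z. indicator unit_cube (x + z) \<partial>count_space integer_points) = (1 :: ennreal)"
    (is "?l = 1")
proof -
  let ?z = "- (\<Sum>b\<in>Basis. of_int \<lfloor>x \<bullet> b\<rfloor> *\<^sub>R b)"
  have "?l = (\<integral>\<^sup>+z. indicator {?z} z \<partial>count_space integer_points)"
    by (rule nn_integral_cong) (auto simp: unit_cube_translate_iff indicator_def)
  also have "\<dots> = 1"
    using floor_vector_integer [of x] by (subst nn_integral_indicator) auto
  finally show ?thesis .
qed

lemma emeasure_Int_nn_integral:
  assumes "A \<in> sets M" and "Measurable.pred M P"
  shows "emeasure M (A \<inter> {x\<in>space M. P x}) = (\<integral>\<^sup>+x. indicator A x * indicator {x. P x} x \<partial>M)"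
proof -
  have "A \<inter> {x\<in>space M. P x} \<in> sets M" using assms by measurable
  then have "emeasure M (A \<inter> {x\<in>space M. P x}) = (\<integral>\<^sup>+x. indicator (A \<inter> {x\<in>space M. P x}) x \<partial>M)"
    by simp
  also have "\<dots> = (\<integral>\<^sup>+x. indicator A x * indicator {x. P x} x \<partial>M)"
    by (rule nn_integral_cong) (auto split: split_indicator)
  finally show ?thesis .
qed

text \<open>Unfolding: the partition of unity at \<open>x + s\<close> turns the integral over the
  cube into one over space and lattice. After a substitution the sum collapses over the other cube
  factor.\<close>

lemma emeasure_periodic_translate:
  fixes A :: "'a::euclidean_space set"
  assumes A [measurable]: "A \<in> sets borel" and per: "lattice_periodic A"
  shows "emeasure lborel (unit_cube \<inter> {x. x + s \<in> A}) = emeasure lborel (unit_cube \<inter> A)"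
proof -
  have tr: "(\<integral>\<^sup>+x. f x \<partial>lborel) = (\<integral>\<^sup>+x. f (x + c) \<partial>lborel)"
    if [measurable]: "f \<in> borel_measurable borel" for f :: "'a \<Rightarrow> ennreal" and c
    by (subst lborel_distr_plus [of c, symmetric]) (simp add: nn_integral_distr add.commute)
  have "emeasure lborel (unit_cube \<inter> {x. x + s \<in> A}) =
      (\<integral>\<^sup>+x. indicator unit_cube x * indicator A (x + s) \<partial>lborel)"
    using emeasure_Int_nn_integral [of unit_cube lborel "\<lambda>x. x + s \<in> A"]
    by (simp add: indicator_def)
  also have "\<dots> = (\<integral>\<^sup>+x. (\<integral>\<^sup>+z. indicator unit_cube x * indicator A (x + s) *
      indicator unit_cube ((x + s) + z) \<partial>count_space integer_points) \<partial>lborel)"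
    by (subst nn_integral_cmult) (auto simp: nn_integral_integer_translates)
  also have "\<dots> = (\<integral>\<^sup>+z. (\<integral>\<^sup>+x. indicator unit_cube x * indicator A (x + s) *
      indicator unit_cube ((x + s) + z) \<partial>lborel) \<partial>count_space integer_points)"
    by (rule nn_integral_count_space_nn_integral [OF countable_integer_points]) measurable
  \<comment> \<open>The substitution shifts \<open>x\<close> by \<open>- s - z\<close>; periodicity
    then removes \<open>z\<close> from the argument of \<open>A\<close>.\<close>
  also have "\<dots> = (\<integral>\<^sup>+z. (\<integral>\<^sup>+x. indicator unit_cube ((x - s) + (- z)) * indicator A x *
      indicator unit_cube x \<partial>lborel) \<partial>count_space integer_points)"
  proof (rule nn_integral_cong)
    fix z :: 'a assume "z \<in> space (count_space integer_points)"
    then have z: "- z \<in> integer_points" by (simp add: integer_points_uminus)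
    have "indicator A (x - z) = (indicator A x :: ennreal)" for x
      using lattice_periodic_iff [OF per z, of x] by (simp split: split_indicator)
    then show "(\<integral>\<^sup>+x. indicator unit_cube x * indicator A (x + s) *
        indicator unit_cube ((x + s) + z) \<partial>lborel) =
      (\<integral>\<^sup>+x. indicator unit_cube ((x - s) + (- z)) * indicator A x * indicator unit_cube x \<partial>lborel)"
      by (subst tr [where c = "- s - z"]) (auto simp: algebra_simps)
  qed
  also have "\<dots> = (\<integral>\<^sup>+x. (\<integral>\<^sup>+z. indicator unit_cube ((x - s) + (- z)) * (indicator A x *
      indicator unit_cube x) \<partial>count_space integer_points) \<partial>lborel)"
    by (subst nn_integral_count_space_nn_integral [OF countable_integer_points])
       (simp_all add: mult.assoc)
  also have "\<dots> = (\<integral>\<^sup>+x. indicator A x * indicator unit_cube x \<partial>lborel)"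
  proof (rule nn_integral_cong)
    fix x :: 'a
    have "bij_betw uminus (integer_points :: 'a set) integer_points"
      by (rule bij_betwI [where g = uminus]) (auto simp: integer_points_uminus)
    then have "(\<integral>\<^sup>+z. indicator unit_cube ((x - s) + (- z)) \<partial>count_space integer_points) =
        (\<integral>\<^sup>+z. indicator unit_cube ((x - s) + z) \<partial>count_space integer_points)"
      by (rule nn_integral_bij_count_space)
    then show "(\<integral>\<^sup>+z. indicator unit_cube ((x - s) + (- z)) * (indicator A x *
        indicator unit_cube x) \<partial>count_space integer_points) = indicator A x * indicator unit_cube x"
      by (subst nn_integral_multc) (auto simp: nn_integral_integer_translates)
  qed
  also have "\<dots> = emeasure lborel (unit_cube \<inter> A)"
    using emeasure_Int_nn_integral [of unit_cube lborel "\<lambda>x. x \<in> A"]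
    by (simp add: mult.commute)
  finally show ?thesis .
qed

text \<open>Averaging the translation invariance over a lift of the target cube shows that a surjective
  homomorphism of tori preserves the Haar measure.\<close>

lemma emeasure_torus_hom:
  fixes \<Lambda> :: "'a::euclidean_space \<Rightarrow> 'b::euclidean_space"
  assumes lin: "linear \<Lambda>" and int: "\<And>z. z \<in> integer_points \<Longrightarrow> \<Lambda> z \<in> integer_points"
    and surj: "surj \<Lambda>" and A [measurable]: "A \<in> sets borel" and per: "lattice_periodic A"
  shows "emeasure lborel (unit_cube \<inter> \<Lambda> -` A) = emeasure lborel (unit_cube \<inter> A)"
proof -
  have [measurable]: "\<Lambda> \<in> borel_measurable borel"
    using lin linear_continuous_on linear_conv_bounded_linear borel_measurable_continuous_onI by blast
  have meas: "\<Lambda> -` A \<in> sets borel"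
    using measurable_sets [of \<Lambda> borel borel A] by simp
  have perL: "lattice_periodic (\<Lambda> -` A)"
    using per int unfolding lattice_periodic_def by (simp add: linear_add [OF lin])
  \<comment> \<open>Surjectivity enters here: a shift by \<alpha> in the target lifts to a shift of
    \<open>x\<close>, which preserves the measure.\<close>
  have 1: "emeasure lborel (unit_cube \<inter> {x. \<Lambda> x + \<alpha> \<in> A}) = emeasure lborel (unit_cube \<inter> \<Lambda> -` A)" for \<alpha>
  proof -
    obtain s where "\<alpha> = \<Lambda> s" using surj by blast
    with emeasure_periodic_translate [OF meas perL, of s] show ?thesis
      by (simp add: linear_add [OF lin])
  qed
  have "emeasure lborel (unit_cube \<inter> \<Lambda> -` A) =
      (\<integral>\<^sup>+\<alpha>. emeasure lborel (unit_cube \<inter> \<Lambda> -` A) * indicator unit_cube \<alpha> \<partial>(lborel :: 'b measure))"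
    by (subst nn_integral_cmult_indicator) (auto simp: emeasure_unit_cube)
  also have "\<dots> = (\<integral>\<^sup>+\<alpha>. (\<integral>\<^sup>+x. indicator unit_cube x * indicator A (\<Lambda> x + \<alpha>) * indicator unit_cube \<alpha>
      \<partial>lborel) \<partial>lborel)"
  proof (rule nn_integral_cong)
    fix \<alpha> :: 'b
    have "emeasure lborel (unit_cube \<inter> \<Lambda> -` A) = (\<integral>\<^sup>+x. indicator unit_cube x * indicator A (\<Lambda> x +
        \<alpha>) \<partial>lborel)"
      unfolding 1 [of \<alpha>, symmetric]
      using emeasure_Int_nn_integral [of unit_cube lborel "\<lambda>x. \<Lambda> x + \<alpha> \<in> A"]
      by (simp add: indicator_def)
    then show "emeasure lborel (unit_cube \<inter> \<Lambda> -` A) * indicator unit_cube \<alpha> =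
      (\<integral>\<^sup>+x. indicator unit_cube x * indicator A (\<Lambda> x + \<alpha>) * indicator unit_cube \<alpha> \<partial>lborel)"
      by (subst nn_integral_multc) auto
  qed
  also have "\<dots> = (\<integral>\<^sup>+x. (\<integral>\<^sup>+\<alpha>. indicator unit_cube x * indicator A (\<Lambda> x + \<alpha>) * indicator unit_cube \<alpha>
      \<partial>lborel) \<partial>lborel)"
    by (rule lborel_pair.Fubini') measurable
  also have "\<dots> = (\<integral>\<^sup>+x. emeasure lborel (unit_cube \<inter> A) * indicator unit_cube x \<partial>(lborel :: 'a
      measure))"
  proof (rule nn_integral_cong)
    fix x :: 'a
    have "emeasure lborel (unit_cube \<inter> A) = (\<integral>\<^sup>+\<alpha>. indicator A (\<Lambda> x + \<alpha>) * indicator unit_cube \<alpha>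
        \<partial>lborel)"
      unfolding emeasure_periodic_translate [OF A per, of "\<Lambda> x", symmetric]
      using emeasure_Int_nn_integral [of unit_cube lborel "\<lambda>\<alpha>. \<alpha> + \<Lambda> x \<in> A"]
      by (simp add: indicator_def mult.commute add.commute)
    then show "(\<integral>\<^sup>+\<alpha>. indicator unit_cube x * indicator A (\<Lambda> x + \<alpha>) * indicator unit_cube \<alpha> \<partial>lborel) =
        emeasure lborel (unit_cube \<inter> A) * indicator unit_cube x"
      by (simp add: nn_integral_cmult [symmetric] ac_simps)
  qed
  also have "\<dots> = emeasure lborel (unit_cube \<inter> A)"
    by (subst nn_integral_cmult_indicator) (auto simp: emeasure_unit_cube)
  finally show ?thesis .
qed

text \<open>Second moment method: pairwise independence keeps the variance of the number of
  occurring events below its mean. If none occurs, the deviation equals the mean, and Chebyshev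
  applies.\<close>

lemma (in prob_space) prob_none_pairwise_independent_le:
  assumes fin: "finite Q" and A: "\<And>q. q \<in> Q \<Longrightarrow> A q \<in> events"
    and single: "\<And>q. q \<in> Q \<Longrightarrow> prob (A q) = c"
    and pair: "\<And>q r. q \<in> Q \<Longrightarrow> r \<in> Q \<Longrightarrow> q \<noteq> r \<Longrightarrow> prob (A q \<inter> A r) = c\<^sup>2"
    and pos: "real (card Q) * c > 0"
  shows "prob (space M - (\<Union>q\<in>Q. A q)) \<le> 1 / (real (card Q) * c)"
proof -
  define f where "f x = (\<Sum>q\<in>Q. indicator (A q) x :: real)" for x
  let ?E = "real (card Q) * c"
  note [measurable] = A
  have f [measurable]: "f \<in> borel_measurable M"
    unfolding f_def by measurable
  have int1: "integrable M f"
    unfolding f_def using A by (intro Bochner_Integration.integrable_sum) (simp add: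
        integrable_indicator_iff less_top[symmetric])
  have f2: "(f x)\<^sup>2 = (\<Sum>q\<in>Q. \<Sum>r\<in>Q. indicator (A q \<inter> A r) x)" for x
    by (simp add: f_def power2_eq_square sum_product indicator_inter_arith)
  have int2: "integrable M (\<lambda>x. (f x)\<^sup>2)"
    unfolding f2 using A
    by (intro Bochner_Integration.integrable_sum) (auto simp: integrable_indicator_iff
        less_top[symmetric])
  have Ef: "expectation f = ?E"
    unfolding f_def using A single
    by (subst Bochner_Integration.integral_sum) (auto simp: integrable_indicator_iff
        less_top[symmetric])
  have "expectation (\<lambda>x. (f x)\<^sup>2) = (\<Sum>q\<in>Q. \<Sum>r\<in>Q. prob (A q \<inter> A r))"
    unfolding f2 using A
    by (subst Bochner_Integration.integral_sum, auto simp: integrable_indicator_iff less_top[symmetric]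
          intro!: Bochner_Integration.integrable_sum)+
  \<comment> \<open>Independence gives \<open>c\<^sup>2\<close> off the diagonal; a diagonal term is
    \<open>c\<close>, hence the correction.\<close>
  also have "\<dots> = (\<Sum>q\<in>Q. \<Sum>r\<in>Q. c\<^sup>2 + (if q = r then c - c\<^sup>2 else 0))"
    by (intro sum.cong refl) (auto simp: single pair)
  also have "\<dots> = (real (card Q))\<^sup>2 * c\<^sup>2 + real (card Q) * (c - c\<^sup>2)"
    using fin by (simp add: sum.distrib sum.delta power2_eq_square distrib_left)
  finally have var: "variance f = ?E - real (card Q) * c\<^sup>2"
    by (subst variance_eq [OF int1 int2]) (simp add: Ef algebra_simps power_mult_distrib)
  have "prob (space M - (\<Union>q\<in>Q. A q)) \<le> prob {x \<in> space M. \<bar>f x - expectation f\<bar> \<ge> ?E}"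
  proof (rule finite_measure_mono)
    have "f x = 0" if "x \<in> space M - (\<Union>q\<in>Q. A q)" for x
      using that by (auto simp: f_def)
    then show "space M - (\<Union>q\<in>Q. A q) \<subseteq> {x \<in> space M. \<bar>f x - expectation f\<bar> \<ge> ?E}"
      using Ef by auto
  qed measurable
  also have "\<dots> \<le> variance f / ?E\<^sup>2"
    by (rule Chebyshev_inequality [OF f int2 pos])
  also have "\<dots> \<le> ?E / ?E\<^sup>2"
    unfolding var by (intro divide_right_mono) auto
  also have "\<dots> = 1 / ?E"
    by (simp add: power2_eq_square)
  finally show ?thesis .
qed

text \<open>The whole space has infinite measure, so Borel-Cantelli is applied on each of the
  countably many integer translates of the cube. Some integer translation brings a given
  \<open>x\<close> into the cube, and periodicity carries the conclusion back.\<close>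

lemma AE_eventually_notin_periodic:
  fixes B :: "nat \<Rightarrow> 'a::euclidean_space set"
  assumes B [measurable]: "\<And>k. B k \<in> sets borel" and per: "\<And>k. lattice_periodic (B k)"
    and le: "\<And>k. emeasure lborel (unit_cube \<inter> B k) \<le> ennreal (e k)"
    and e: "\<And>k. 0 \<le> e k" "summable e"
  shows "AE x in lborel. eventually (\<lambda>k. x \<notin> B k) sequentially"
proof -
  have "AE x in lborel. eventually (\<lambda>k. x \<notin> (\<lambda>x. x + z) -` (unit_cube \<inter> B k)) sequentially"
    if "z \<in> integer_points" for z
  proof -
    have em: "emeasure lborel ((\<lambda>x. x + z) -` (unit_cube \<inter> B k)) \<le> ennreal (e k)" for k
    proof -
      have "emeasure lborel (unit_cube \<inter> B k) = emeasure (distr lborel borel ((+) z)) (unit_cube \<inter> B k)"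
        by (simp add: lborel_distr_plus)
      also have "\<dots> = emeasure lborel ((\<lambda>x. x + z) -` (unit_cube \<inter> B k))"
        by (subst emeasure_distr) (auto simp: vimage_def add.commute)
      finally show ?thesis using le [of k] by simp
    qed
    have "AE x in lborel. eventually (\<lambda>k. x \<in> space lborel - (\<lambda>x. x + z) -` (unit_cube \<inter> B k))
        sequentially"
    proof (rule borel_cantelli_AE1)
      show "(\<lambda>x. x + z) -` (unit_cube \<inter> B n) \<in> sets lborel" for n
        using measurable_sets [of "\<lambda>x. x + z" borel borel "unit_cube \<inter> B n"] by simp
      show "emeasure lborel ((\<lambda>x. x + z) -` (unit_cube \<inter> B n)) < \<infinity>" for n
        using em [of n] by (auto intro: le_less_trans)
      have "measure lborel ((\<lambda>x. x + z) -` (unit_cube \<inter> B n)) \<le> e n" for n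
        unfolding measure_def using em [of n] e(1) by (simp add: enn2real_leI)
      then show "summable (\<lambda>n. measure lborel ((\<lambda>x. x + z) -` (unit_cube \<inter> B n)))"
        using e by (intro summable_comparison_test' [OF e(2)]) auto
    qed
    then show ?thesis by simp
  qed
  then have "AE x in lborel. \<forall>z\<in>integer_points.
      eventually (\<lambda>k. x \<notin> (\<lambda>x. x + z) -` (unit_cube \<inter> B k)) sequentially"
    by (subst AE_ball_countable [OF countable_integer_points]) blast
  then show ?thesis
  proof (rule AE_mp [OF _ AE_I2], safe)
    fix x :: 'a
    assume *: "\<forall>z\<in>integer_points. eventually (\<lambda>k. x \<notin> (\<lambda>x. x + z) -` (unit_cube \<inter> B k)) sequentially"
    define z where "z = - (\<Sum>b\<in>Basis. of_int \<lfloor>x \<bullet> b\<rfloor> *\<^sub>R b)"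
    have z: "z \<in> integer_points" unfolding z_def by (rule floor_vector_integer)
    have xz: "x + z \<in> unit_cube"
      using unit_cube_translate_iff [OF z] z_def by blast
    from * z have "eventually (\<lambda>k. x \<notin> (\<lambda>x. x + z) -` (unit_cube \<inter> B k)) sequentially" by blast
    then show "eventually (\<lambda>k. x \<notin> B k) sequentially"
      by eventually_elim (use xz lattice_periodic_iff [OF per z] in auto)
  qed
qed

text \<open>Fubini: average the measure of \<open>A\<close> shifted along \<open>v\<close> over
  \<open>t\<close> in \<open>[0, 1]\<close> and integrate in \<open>t\<close> first. The inner
  integral is over a countable set.\<close>

lemma null_set_if_countable_lines:
  fixes A :: "'a::euclidean_space set"
  assumes A [measurable]: "A \<in> sets borel" and count: "\<And>x. countable {t::real. x + t *\<^sub>R v \<in> A}"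
  shows "A \<in> null_sets lborel"
proof -
  have "emeasure lborel A = (\<integral>\<^sup>+t. emeasure lborel A * indicator {0..1} t \<partial>(lborel :: real measure))"
    by (subst nn_integral_cmult_indicator) auto
  also have "\<dots> = (\<integral>\<^sup>+t. (\<integral>\<^sup>+x. indicator A (x + t *\<^sub>R v) * indicator {0..1} t \<partial>lborel) \<partial>(lborel ::
      real measure))"
  proof (rule nn_integral_cong)
    fix t :: real
    have "emeasure lborel A = (\<integral>\<^sup>+x. indicator A x \<partial>distr lborel borel ((+) (t *\<^sub>R v)))"
      by (simp add: lborel_distr_plus)
    also have "\<dots> = (\<integral>\<^sup>+x. indicator A (x + t *\<^sub>R v) \<partial>lborel)"
      by (subst nn_integral_distr) (auto simp: add.commute)
    finally show "emeasure lborel A * indicator {0..1} t =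
      (\<integral>\<^sup>+x. indicator A (x + t *\<^sub>R v) * indicator {0..1} t \<partial>lborel)"
      by (simp add: nn_integral_multc)
  qed
  also have "\<dots> = (\<integral>\<^sup>+x. (\<integral>\<^sup>+t. indicator A (x + t *\<^sub>R v) * indicator {0..1::real} t \<partial>lborel) \<partial>lborel)"
    by (rule lborel_pair.Fubini') measurable
  also have "\<dots> = (\<integral>\<^sup>+x. 0 \<partial>(lborel :: 'a measure))"
  proof (rule nn_integral_cong)
    fix x :: 'a
    have "{t. x + t *\<^sub>R v \<in> A} \<in> null_sets lborel"
      using count by (rule countable_imp_null_set_lborel)
    then have "AE t in lborel. indicator A (x + t *\<^sub>R v) * indicator {0..1::real} t = (0::ennreal)"
      by (rule AE_not_in [THEN AE_mp]) (auto simp: indicator_def)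
    then show "(\<integral>\<^sup>+t. indicator A (x + t *\<^sub>R v) * indicator {0..1::real} t \<partial>lborel) = 0"
      by (subst nn_integral_0_iff_AE) auto
  qed
  finally show ?thesis by (auto intro: null_setsI)
qed

section \<open>Zeros of a determinant along a line\<close>

lemma det_scaleR: "det (c *\<^sub>R A) = c ^ CARD('m) * det A" for A :: "real ^ 'm ^ 'm"
  by (simp add: det_def prod.distrib sum_distrib_left mult_ac)

text \<open>The reversed polynomial \<open>det (mat 1 + s *\<^sub>R A)\<close> is visibly nonzero,
  being 1 at \<open>s = 0\<close>. A zero \<open>t\<close> other than 0 gives its root
  \<open>1 / t\<close>.\<close>

lemma finite_det_line_zeros:
  fixes A :: "real ^ 'm ^ 'm"
  shows "finite {t. det (A + t *\<^sub>R mat 1) = 0}"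
proof -
  define P where "P = (\<Sum>\<sigma> | \<sigma> permutes (UNIV :: 'm set).
    of_int (sign \<sigma>) * (\<Prod>i\<in>UNIV. [: mat 1 $ i $ \<sigma> i, A $ i $ \<sigma> i :]))"
  have P: "poly P s = det (mat 1 + s *\<^sub>R A)" for s
    by (simp add: P_def det_def poly_sum poly_prod)
  have "poly P 0 = 1" by (simp add: P)
  then have "finite {s. poly P s = 0}" by (intro poly_roots_finite) auto
  moreover have "{t. det (A + t *\<^sub>R mat 1) = 0} \<subseteq> insert 0 (inverse ` {s. poly P s = 0})"
  proof safe
    fix t assume t: "det (A + t *\<^sub>R mat 1) = 0" "t \<notin> inverse ` {s. poly P s = 0}"
    show "t = 0"
    proof (rule ccontr)
      assume "t \<noteq> 0"
      then have "mat 1 + inverse t *\<^sub>R A = inverse t *\<^sub>R (A + t *\<^sub>R mat 1)"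
        by (simp add: algebra_simps)
      then have "poly P (inverse t) = 0"
        using t(1) unfolding P by (simp add: det_scaleR)
      moreover have "t = inverse (inverse t)" by simp
      ultimately show False using t(2) by blast
    qed
  qed
  ultimately show ?thesis by (meson finite.insertI finite_imageI finite_subset)
qed

section \<open>Distribution of the rows modulo the integer lattice\<close>

lemma lattice_periodic_Compl: "lattice_periodic A \<Longrightarrow> lattice_periodic (- A)"
  using lattice_periodic_iff unfolding lattice_periodic_def [of "- A"] by blast

lemma lattice_periodic_UN: "(\<And>q. q \<in> Q \<Longrightarrow> lattice_periodic (A q)) \<Longrightarrow> lattice_periodic (\<Union>q\<in>Q. A q)"
  unfolding lattice_periodic_def by blast

lemma lattice_periodic_translate: "lattice_periodic A \<Longrightarrow> lattice_periodic {x. x + c \<in> A}"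
  by (auto simp: lattice_periodic_def algebra_simps)

lemma integer_points_vec_iff:
  fixes z :: "'a::euclidean_space ^ 'i"
  shows "z \<in> integer_points \<longleftrightarrow> (\<forall>i. z $ i \<in> integer_points)"
  by (auto simp: integer_points_def Basis_vec_def inner_axis)

lemma integer_points_real_iff: "(z::real) \<in> integer_points \<longleftrightarrow> z \<in> \<int>"
  by (simp add: integer_points_def)

lemma integer_points_Pair_iff:
  "(z, w) \<in> integer_points \<longleftrightarrow> z \<in> integer_points \<and> w \<in> integer_points"
  by (simp add: integer_points_def Basis_prod_def ball_Un)

lemma unit_cube_Times: "(unit_cube :: ('a::euclidean_space \<times> 'b::euclidean_space) set) = unit_cube
    \<times> unit_cube"
  by (auto simp: unit_cube_def Basis_prod_def ball_Un)

text \<open>One-sided boxes suit the rounding down that later builds \<gamma>: its errors are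
  fractional parts.\<close>

definition frac_box :: "real \<Rightarrow> (real ^ 'p) set" where
  "frac_box \<delta> = {v. \<forall>j. frac (v $ j) < \<delta>}"

lemma frac_box_borel [measurable]: "frac_box \<delta> \<in> sets borel"
  unfolding frac_box_def frac_def by measurable

lemma frac_add_Ints: "z \<in> \<int> \<Longrightarrow> frac (x + z) = frac x"
  by (auto simp: Ints_def frac_def)

lemma lattice_periodic_frac_box: "lattice_periodic (frac_box \<delta>)"
  by (auto simp: lattice_periodic_def frac_box_def integer_points_vec_iff integer_points_real_iff
      frac_add_Ints)

lemma emeasure_frac_box:
  assumes "0 \<le> \<delta>" "\<delta> \<le> 1"
  shows "emeasure lborel (unit_cube \<inter> (frac_box \<delta> :: (real ^ 'p) set)) = ennreal (\<delta> ^ CARD('p))"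
proof (rule antisym)
  let ?d = "(\<chi> j. \<delta>) :: real ^ 'p"
  have Basis: "b \<in> Basis \<longleftrightarrow> (\<exists>j. b = axis j 1)" for b :: "real ^ 'p"
    by (auto simp: Basis_vec_def)
  have eq: "unit_cube \<inter> frac_box \<delta> = {v :: real ^ 'p. \<forall>j. 0 \<le> v $ j \<and> v $ j < \<delta>}"
  proof (rule set_eqI)
    fix v :: "real ^ 'p"
    have "v \<in> unit_cube \<longleftrightarrow> (\<forall>j. 0 \<le> v $ j \<and> v $ j < 1)"
      by (simp add: unit_cube_def Basis_vec_def inner_axis)
    then have "v \<in> unit_cube \<inter> frac_box \<delta> \<longleftrightarrow> (\<forall>j. (0 \<le> v $ j \<and> v $ j < 1) \<and> frac (v $ j) < \<delta>)"
      by (auto simp: frac_box_def)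
    moreover have "(0 \<le> t \<and> t < 1) \<and> frac t < \<delta> \<longleftrightarrow> 0 \<le> t \<and> t < \<delta>" for t :: real
      using assms by (cases "0 \<le> t \<and> t < 1") (auto simp: frac_eq)
    ultimately show "v \<in> unit_cube \<inter> frac_box \<delta> \<longleftrightarrow> v \<in> {v. \<forall>j. 0 \<le> v $ j \<and> v $ j < \<delta>}"
      by simp
  qed
  have prod: "(\<Prod>b\<in>Basis. ?d \<bullet> b) = \<delta> ^ CARD('p)"
  proof -
    have "(\<Prod>b\<in>Basis. ?d \<bullet> b) = (\<Prod>b\<in>(Basis :: (real ^ 'p) set). \<delta>)"
      by (intro prod.cong) (auto simp: Basis inner_axis)
    then show ?thesis by simp
  qed
  have le: "0 \<bullet> b \<le> ?d \<bullet> b" if "b \<in> Basis" for b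
    using that assms by (auto simp: Basis inner_axis)
  have "emeasure lborel (unit_cube \<inter> (frac_box \<delta> :: (real ^ 'p) set)) \<le> emeasure lborel (cbox 0 ?d)"
    by (intro emeasure_mono) (auto simp: eq mem_box_cart less_imp_le)
  also have "\<dots> = ennreal (\<delta> ^ CARD('p))"
    using le prod by (subst emeasure_lborel_cbox) auto
  finally show "emeasure lborel (unit_cube \<inter> (frac_box \<delta> :: (real ^ 'p) set)) \<le> ennreal (\<delta> ^
      CARD('p))" .
  have "ennreal (\<delta> ^ CARD('p)) = emeasure lborel (box 0 ?d)"
    using le prod by (subst emeasure_lborel_box) auto
  also have "\<dots> \<le> emeasure lborel (unit_cube \<inter> (frac_box \<delta> :: (real ^ 'p) set))"
    by (intro emeasure_mono) (auto simp: eq mem_box_cart less_imp_le)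
  finally show "ennreal (\<delta> ^ CARD('p)) \<le> emeasure lborel (unit_cube \<inter> (frac_box \<delta> :: (real ^ 'p)
      set))" .
qed

text \<open>For \<open>\<delta> > 1\<close> the box contains the whole cube. This case occurs for
  the doubled radius of the upper bound at small scales.\<close>

lemma emeasure_frac_box_le:
  assumes "0 \<le> \<delta>"
  shows "emeasure lborel (unit_cube \<inter> (frac_box \<delta> :: (real ^ 'p) set)) \<le> ennreal (\<delta> ^ CARD('p))"
proof (cases "\<delta> \<le> 1")
  case True
  with assms show ?thesis by (simp add: emeasure_frac_box)
next
  case False
  have "emeasure lborel (unit_cube \<inter> (frac_box \<delta> :: (real ^ 'p) set)) \<le> emeasure lborel (unit_cube
      :: (real ^ 'p) set)"
    by (intro emeasure_mono) auto
  also have "\<dots> \<le> ennreal (\<delta> ^ CARD('p))"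
    using False by (simp add: emeasure_unit_cube)
  finally show ?thesis .
qed

text \<open>\<iota> marks the rows of \<open>x\<close> to be normalized to the identity block. The
  columns of \<gamma> with these indices are filled by rounding.\<close>

locale row_selection =
  fixes \<iota> :: "'p::finite \<Rightarrow> 'n::finite"
  assumes inj: "inj \<iota>" and card_less: "CARD('p) < CARD('n)"
begin

definition free_rows :: "'n set" where "free_rows = - range \<iota>"

lemma card_free_rows: "card free_rows = CARD('n) - CARD('p)"
  unfolding free_rows_def using inj by (simp add: Compl_eq_Diff_UNIV card_Diff_subset card_image)

text \<open>With \<open>u = (x, y)\<close> and \<open>q\<close> the free entries of row
  \<open>i\<close> of \<gamma>, this is row \<open>i\<close> of
  \<open>\<gamma> ** normal x - y\<close> up to the integers standing in the selected
  columns.\<close>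

definition row_map :: "('n \<Rightarrow> int) \<Rightarrow> 'n \<Rightarrow> (real ^ 'p ^ 'n) \<times> (real ^ 'p ^ 'n) \<Rightarrow> real ^ 'p" where
  "row_map q i u = (\<Sum>a\<in>free_rows. of_int (q a) *\<^sub>R fst u $ a) - snd u $ i"

lemma linear_row_map: "linear (row_map q i)"
  by (rule linearI)
    (simp_all add: row_map_def sum.distrib scaleR_right_distrib scaleR_right_diff_distrib
        scaleR_sum_right mult.commute)

lemma row_map_integer:
  assumes "z \<in> integer_points"
  shows "row_map q i z \<in> integer_points"
  using assms by (cases z) (auto simp: row_map_def integer_points_Pair_iff integer_points_vec_iff
    integer_points_real_iff intro!: Ints_diff Ints_sum Ints_mult)

lemma row_map_borel [measurable]: "row_map q i \<in> borel_measurable borel"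
  by (intro borel_measurable_continuous_onI linear_continuous_on)
     (simp add: linear_row_map linear_conv_bounded_linear [symmetric])

lemma row_map_cong: "(\<And>a. a \<in> free_rows \<Longrightarrow> q a = r a) \<Longrightarrow> row_map q i u = row_map r i u"
  by (simp add: row_map_def)

lemma row_map_axis:
  assumes "a \<in> free_rows"
  shows "row_map q i (axis a v, axis i w) = of_int (q a) *\<^sub>R v - w"
proof -
  have "(\<Sum>b\<in>free_rows. of_int (q b) *\<^sub>R axis a v $ b) = (\<Sum>b\<in>free_rows. if b = a then of_int (q a)
      *\<^sub>R v else 0)"
    by (intro sum.cong) (auto simp: axis_def)
  then show ?thesis using assms by (simp add: row_map_def)
qed

lemma ex_free_row: "\<exists>a. a \<in> free_rows"
proof -
  have "card free_rows > 0" using card_less by (simp add: card_free_rows)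
  then show ?thesis by (auto simp: card_gt_0_iff)
qed

text \<open>Row \<open>i\<close> of \<open>y\<close> enters with coefficient -1, so it alone reaches
  every value, even for \<open>q = 0\<close>.\<close>

lemma surj_row_map: "surj (row_map q i)"
proof -
  obtain a where "a \<in> free_rows" using ex_free_row by blast
  then have "row_map q i (axis a 0, axis i (- v)) = v" for v
    by (simp add: row_map_axis)
  then show ?thesis unfolding surj_def by metis
qed

text \<open>The difference of the two equations involves row \<open>a\<close> of \<open>x\<close>
  with the nonzero factor \<open>q a - r a\<close>; row \<open>i\<close> of \<open>y\<close> then
  settles either equation.\<close>

lemma surj_row_map_Pair:
  assumes a: "a \<in> free_rows" and neq: "q a \<noteq> r a"
  shows "surj (\<lambda>u. (row_map q i u, row_map r i u))"
proof -
  have "\<exists>u. (row_map q i u, row_map r i u) = (\<alpha>, \<beta>)" for \<alpha> \<beta>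
  proof -
    define v where "v = inverse (of_int (q a) - of_int (r a)) *\<^sub>R (\<alpha> - \<beta>)"
    have "of_int (q a) *\<^sub>R v - of_int (r a) *\<^sub>R v = \<alpha> - \<beta>"
      using neq by (simp add: v_def flip: scaleR_left_diff_distrib left_diff_distrib)
    then have "row_map r i (axis a v, axis i (of_int (q a) *\<^sub>R v - \<alpha>)) = \<beta>"
      by (simp add: row_map_axis a algebra_simps)
    moreover have "row_map q i (axis a v, axis i (of_int (q a) *\<^sub>R v - \<alpha>)) = \<alpha>"
      by (simp add: row_map_axis a)
    ultimately show ?thesis by blast
  qed
  then show ?thesis unfolding surj_def by (metis prod.collapse)
qed

lemma emeasure_row_map:
  "A \<in> sets borel \<Longrightarrow> lattice_periodic A \<Longrightarrow>
    emeasure lborel (unit_cube \<inter> row_map q i -` A) = emeasure lborel (unit_cube \<inter> A)"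
  by (rule emeasure_torus_hom [OF linear_row_map row_map_integer surj_row_map])

text \<open>Pairwise independence: the pair of maps is again a surjective torus homomorphism, and
  the measure of \<open>A \<times> A\<close> factorizes.\<close>

lemma emeasure_row_map_pair:
  assumes a: "a \<in> free_rows" and neq: "q a \<noteq> r a"
    and A: "A \<in> sets borel" "lattice_periodic A"
  shows "emeasure lborel (unit_cube \<inter> row_map q i -` A \<inter> row_map r i -` A) =
    emeasure lborel (unit_cube \<inter> A) * emeasure lborel (unit_cube \<inter> A)"
proof -
  let ?L = "\<lambda>u. (row_map q i u, row_map r i u)"
  have "linear ?L"
    by (rule linearI) (simp_all add: linear_add [OF linear_row_map] linear_scale [OF linear_row_map])
  moreover have "?L z \<in> integer_points" if "z \<in> integer_points" for z
    using that by (simp add: integer_points_Pair_iff row_map_integer)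
  moreover have "surj ?L" by (rule surj_row_map_Pair [of a]) fact+
  moreover have "A \<times> A \<in> sets borel" using A by (simp add: borel_Times)
  moreover have "lattice_periodic (A \<times> A)"
    using A unfolding lattice_periodic_def by (auto simp: integer_points_Pair_iff)
  ultimately have "emeasure lborel (unit_cube \<inter> ?L -` (A \<times> A)) = emeasure lborel (unit_cube \<inter> (A \<times> A))"
    by (rule emeasure_torus_hom)
  also have "unit_cube \<inter> (A \<times> A) = (unit_cube \<inter> A) \<times> (unit_cube \<inter> A)"
    by (auto simp: unit_cube_Times)
  also have "emeasure lborel \<dots> = emeasure lborel (unit_cube \<inter> A) * emeasure lborel (unit_cube \<inter> A)"
    using A by (subst lborel_prod [symmetric], subst lborel.emeasure_pair_measure_Times) auto
  finally show ?thesis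
    by (simp add: vimage_def Int_def conj_assoc)
qed

section \<open>Borel-Cantelli for the rows at the scales \<open>2 ^ k\<close>\<close>

lemma lattice_periodic_row_map: "lattice_periodic A \<Longrightarrow> lattice_periodic (row_map q i -` A)"
  unfolding lattice_periodic_def
  by (auto simp: linear_add [OF linear_row_map] row_map_integer)

text \<open>There are \<open>2 ^ (k * (n - p))\<close> vectors \<open>q\<close>, each hitting with
  probability \<open>2 powr (- \<mu> * k * p)\<close>, so the expected number of hits grows
  geometrically. The corner \<open>z k\<close> is arbitrary because the second moment bound uses
  only that the vectors are distinct.\<close>

lemma AE_row_map_hits:
  fixes z :: "nat \<Rightarrow> 'n \<Rightarrow> int" and \<mu> :: real
  assumes \<mu>: "0 \<le> \<mu>" "\<mu> * CARD('p) < real CARD('n) - real CARD('p)"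
  shows "AE u in lborel. eventually (\<lambda>k. \<exists>q \<in> (\<Pi>\<^sub>E a\<in>free_rows. {z k a ..< z k a + 2 ^ k}).
           \<forall>j. frac (row_map q i u $ j) < 2 powr (- \<mu> * k)) sequentially"
proof -
  define Q where "Q k = (\<Pi>\<^sub>E a\<in>free_rows. {z k a ..< z k a + 2 ^ k})" for k
  define \<delta> where "\<delta> k = 2 powr (- \<mu> * real k)" for k :: nat
  define m where "m = CARD('n) - CARD('p)"
  \<comment> \<open>\<open>inverse r ^ k\<close> is the expected number of hits at scale
    \<open>k\<close>, so \<open>r ^ k\<close> bounds the probability of having none.\<close>
  define r where "r = 2 powr (\<mu> * CARD('p) - m)"
  define H where "H k q = row_map q i -` frac_box (\<delta> k)" for k q
  have \<delta>: "0 < \<delta> k" "\<delta> k \<le> 1" for k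
    using \<mu> by (auto simp: \<delta>_def powr_le_one_le powr_minus divide_simps ge_one_powr_ge_zero)
  have rm: "real m = real CARD('n) - real CARD('p)" using card_less by (simp add: m_def)
  have card: "card (Q k) = 2 ^ (k * m)" for k
    unfolding Q_def by (subst card_PiE) (auto simp: card_free_rows m_def power_mult nat_power_eq)
  have fin: "finite (Q k)" for k
    unfolding Q_def by (intro finite_PiE) auto
  have H: "H k q \<in> sets borel" for k q
    unfolding H_def using measurable_sets [OF row_map_borel frac_box_borel] by simp
  let ?M = "uniform_measure lborel (unit_cube :: ((real ^ 'p ^ 'n) \<times> (real ^ 'p ^ 'n)) set)"
  interpret prob_space ?M
    by (rule prob_space_uniform_measure) (auto simp: emeasure_unit_cube)
  have M: "emeasure ?M B = emeasure lborel (unit_cube \<inter> B)" if "B \<in> sets borel" for B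
    using that by (simp add: emeasure_unit_cube divide_ennreal_def)
  have e: "emeasure lborel (unit_cube \<inter> (- (\<Union>q\<in>Q k. H k q))) \<le> ennreal (r ^ k)" for k
  proof -
    let ?c = "\<delta> k ^ CARD('p)"
    have E: "real (card (Q k)) * ?c = inverse r ^ k"
    proof -
      have "real (card (Q k)) * ?c = 2 powr (real k * m) * 2 powr (- \<mu> * real k * CARD('p))"
        unfolding card \<delta>_def by (simp add: powr_powr powr_realpow [symmetric])
      also have "\<dots> = 2 powr (- (\<mu> * CARD('p) - m) * k)"
        by (simp add: powr_add [symmetric] algebra_simps)
      also have "\<dots> = inverse r ^ k"
        by (simp add: r_def powr_minus [symmetric] powr_realpow [symmetric] powr_powr)
      finally show ?thesis .
    qed
    have r: "r > 0" by (simp add: r_def)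
    have "prob (space ?M - (\<Union>q\<in>Q k. H k q)) \<le> 1 / (real (card (Q k)) * ?c)"
    proof (rule prob_none_pairwise_independent_le [OF fin])
      show "H k q \<in> events" for q using H by simp
      show "prob (H k q) = ?c" for q
        unfolding measure_def M [OF H] unfolding H_def
        using \<delta> [of k] by (simp add: emeasure_row_map lattice_periodic_frac_box emeasure_frac_box)
      show "prob (H k q \<inter> H k s) = ?c\<^sup>2" if qs: "q \<in> Q k" "s \<in> Q k" "q \<noteq> s" for q s
      proof -
        \<comment> \<open>Members of \<open>Q k\<close> are extensional, so distinct ones differ at
          a free row.\<close>
        obtain a where a: "a \<in> free_rows" "q a \<noteq> s a"
          using qs unfolding Q_def by (meson PiE_ext)
        have "emeasure ?M (H k q \<inter> H k s) = ennreal ?c * ennreal ?c"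
          unfolding M [OF sets.Int [OF H H]] Int_assoc [symmetric] unfolding H_def
          using \<delta> [of k] by (subst emeasure_row_map_pair [where a = a]) (auto simp: a
              lattice_periodic_frac_box emeasure_frac_box)
        then show ?thesis
          using \<delta> [of k] by (simp add: measure_def ennreal_mult [symmetric] power2_eq_square)
      qed
      show "real (card (Q k)) * ?c > 0" unfolding E using r by simp
    qed
    also have "\<dots> = r ^ k" unfolding E by (simp add: power_inverse divide_simps)
    finally have "prob (- (\<Union>q\<in>Q k. H k q)) \<le> r ^ k" by (simp add: Compl_eq_Diff_UNIV)
    then have "emeasure ?M (- (\<Union>q\<in>Q k. H k q)) \<le> ennreal (r ^ k)"
      using r by (simp add: emeasure_eq_measure)
    moreover have "- (\<Union>q\<in>Q k. H k q) \<in> sets borel"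
      using H fin by (intro borel_comp sets.finite_UN) auto
    ultimately show ?thesis by (simp only: M)
  qed
  have "AE u in lborel. eventually (\<lambda>k. u \<notin> - (\<Union>q\<in>Q k. H k q)) sequentially"
  proof (rule AE_eventually_notin_periodic [OF _ _ e])
    show "- (\<Union>q\<in>Q k. H k q) \<in> sets borel" for k
      using H fin by (intro borel_comp sets.finite_UN) auto
    show "lattice_periodic (- (\<Union>q\<in>Q k. H k q))" for k
      unfolding H_def
      by (intro lattice_periodic_Compl lattice_periodic_UN lattice_periodic_row_map
          lattice_periodic_frac_box)
    have "r < 1" using \<mu> by (simp add: r_def rm powr_less_one)
    then show "summable (\<lambda>k. r ^ k)" by (simp add: r_def summable_geometric)
  qed (simp add: r_def)
  then show ?thesis
    by (simp add: H_def Q_def \<delta>_def frac_box_def Bex_def)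
qed

text \<open>Union bound: the number of vectors \<open>q\<close> times the volume of the target is a
  constant times \<open>r ^ k\<close>, with \<open>r < 1\<close> by the hypothesis on \<mu>.\<close>

lemma AE_row_map_misses:
  fixes \<mu> :: real
  assumes \<mu>: "\<mu> * CARD('p) > real CARD('n) - real CARD('p)"
  shows "AE u in lborel. eventually (\<lambda>k. \<forall>q. (\<forall>a\<in>free_rows. \<bar>q a\<bar> \<le> 2 ^ k) \<longrightarrow>
           \<not> (\<forall>j. frac (row_map q i u $ j + 2 powr (- \<mu> * k)) < 2 * 2 powr (- \<mu> * k))) sequentially"
proof -
  define Q where "Q k = (\<Pi>\<^sub>E a\<in>free_rows. {- (2 ^ k) .. 2 ^ k :: int})" for k :: nat
  define \<delta> where "\<delta> k = 2 powr (- \<mu> * real k)" for k :: nat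
  define m where "m = CARD('n) - CARD('p)"
  define r where "r = 2 powr (m - \<mu> * CARD('p))"
  \<comment> \<open>The shift by \<open>\<delta> k\<close> turns the two-sided target of radius
    \<open>\<delta> k\<close> around the lattice into a one-sided box.\<close>
  define A :: "nat \<Rightarrow> (real ^ 'p) set" where "A k = {v. v + (\<chi> j. \<delta> k) \<in> frac_box (2 * \<delta> k)}" for k
  define H where "H k q = row_map q i -` A k" for k q
  have rm: "real m = real CARD('n) - real CARD('p)" using card_less by (simp add: m_def)
  have card: "card (Q k) \<le> (4 * 2 ^ k) ^ m" for k
  proof -
    have "card (Q k) = (nat (2 * 2 ^ k + 1)) ^ m"
      unfolding Q_def by (subst card_PiE) (auto simp: card_free_rows m_def algebra_simps)
    also have "\<dots> \<le> (4 * 2 ^ k) ^ m"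
    proof (intro power_mono)
      have "(1::int) \<le> 2 ^ k" by simp
      then have "2 * 2 ^ k + 1 \<le> 4 * (2::int) ^ k" by linarith
      then show "nat (2 * 2 ^ k + 1) \<le> 4 * 2 ^ k" by (simp only: nat_le_iff) simp
    qed simp
    finally show ?thesis .
  qed
  have fin: "finite (Q k)" for k
    unfolding Q_def by (intro finite_PiE) auto
  have A: "A k \<in> sets borel" for k unfolding A_def by measurable
  have per: "lattice_periodic (A k)" for k
    unfolding A_def by (intro lattice_periodic_translate lattice_periodic_frac_box)
  have H: "H k q \<in> sets borel" for k q
    unfolding H_def using measurable_sets [OF row_map_borel A] by simp
  have HA: "emeasure lborel (unit_cube \<inter> H k q) \<le> ennreal ((2 * \<delta> k) ^ CARD('p))" for k q
    unfolding H_def emeasure_row_map [OF A per] unfolding A_def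
    by (subst emeasure_periodic_translate [OF frac_box_borel lattice_periodic_frac_box],
        rule emeasure_frac_box_le) (simp add: \<delta>_def)
  have e: "emeasure lborel (unit_cube \<inter> (\<Union>q\<in>Q k. H k q)) \<le> ennreal (4 ^ m * 2 ^ CARD('p) * r ^ k)" for k
  proof -
    have "emeasure lborel (unit_cube \<inter> (\<Union>q\<in>Q k. H k q)) = emeasure lborel (\<Union>q\<in>Q k. unit_cube \<inter> H k q)"
      by simp
    also have "\<dots> \<le> (\<Sum>q\<in>Q k. emeasure lborel (unit_cube \<inter> H k q))"
      using H fin by (intro emeasure_subadditive_finite) auto
    also have "\<dots> \<le> (\<Sum>q\<in>Q k. ennreal ((2 * \<delta> k) ^ CARD('p)))"
      by (intro sum_mono HA)
    also have "\<dots> = ennreal (real (card (Q k)) * (2 * \<delta> k) ^ CARD('p))"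
      by (simp add: ennreal_mult \<delta>_def ennreal_of_nat_eq_real_of_nat)
    also have "\<dots> \<le> ennreal (real ((4 * 2 ^ k) ^ m) * (2 * \<delta> k) ^ CARD('p))"
      using card [of k] by (intro ennreal_leI mult_right_mono of_nat_mono) (auto simp: \<delta>_def)
    also have "real ((4 * 2 ^ k) ^ m) * (2 * \<delta> k) ^ CARD('p) = 4 ^ m * 2 ^ CARD('p) * r ^ k"
    proof -
      have "2 ^ (k * m) * \<delta> k ^ CARD('p) = 2 powr (real k * m) * 2 powr (- \<mu> * real k * CARD('p))"
        unfolding \<delta>_def by (simp add: powr_powr powr_realpow [symmetric])
      also have "\<dots> = 2 powr ((m - \<mu> * CARD('p)) * k)"
        by (simp add: powr_add [symmetric] algebra_simps)
      also have "\<dots> = r ^ k"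
        by (simp add: r_def powr_realpow [symmetric] powr_powr)
      finally show ?thesis by (simp add: power_mult_distrib power_mult)
    qed
    finally show ?thesis .
  qed
  have "AE u in lborel. eventually (\<lambda>k. u \<notin> (\<Union>q\<in>Q k. H k q)) sequentially"
  proof (rule AE_eventually_notin_periodic [OF _ _ e])
    show "(\<Union>q\<in>Q k. H k q) \<in> sets borel" for k
      using H fin by (intro sets.finite_UN) auto
    show "lattice_periodic (\<Union>q\<in>Q k. H k q)" for k
      unfolding H_def by (intro lattice_periodic_UN lattice_periodic_row_map per)
    have "r < 1" using \<mu> by (simp add: r_def rm powr_less_one)
    then show "summable (\<lambda>k. 4 ^ m * 2 ^ CARD('p) * r ^ k)"
      by (intro summable_mult summable_geometric) (simp add: r_def)
  qed (simp add: r_def)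
  then show ?thesis
  proof (rule AE_mp, intro AE_I2 impI)
    fix u assume "eventually (\<lambda>k. u \<notin> (\<Union>q\<in>Q k. H k q)) sequentially"
    then show "eventually (\<lambda>k. \<forall>q. (\<forall>a\<in>free_rows. \<bar>q a\<bar> \<le> 2 ^ k) \<longrightarrow>
           \<not> (\<forall>j. frac (row_map q i u $ j + 2 powr (- \<mu> * k)) < 2 * 2 powr (- \<mu> * k))) sequentially"
    proof (eventually_elim, intro allI impI notI)
      fix k q
      assume notin: "u \<notin> (\<Union>q\<in>Q k. H k q)" and q: "\<forall>a\<in>free_rows. \<bar>q a\<bar> \<le> 2 ^ k"
        and *: "\<forall>j. frac (row_map q i u $ j + 2 powr (- \<mu> * k)) < 2 * 2 powr (- \<mu> * k)"
      \<comment> \<open>Only the values of \<open>q\<close> at free rows matter, so an arbitrary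
        \<open>q\<close> reduces to a member of the finite index set.\<close>
      have "restrict q free_rows \<in> Q k" using q by (fastforce simp: Q_def abs_le_iff)
      moreover have "row_map (restrict q free_rows) i u = row_map q i u"
        by (rule row_map_cong) auto
      ultimately show False
        using notin * by (force simp: H_def A_def frac_box_def \<delta>_def)
    qed
  qed
qed

end

section \<open>The upper bound\<close>

lemma max_norm_less_iff: "max_norm A < e \<longleftrightarrow> (\<forall>i j. \<bar>A $ i $ j\<bar> < e)"
  and max_norm_le_iff: "max_norm A \<le> e \<longleftrightarrow> (\<forall>i j. \<bar>A $ i $ j\<bar> \<le> e)"
proof -
  have *: "{\<bar>A $ i $ j\<bar> | i j. True} = (\<lambda>(i, j). \<bar>A $ i $ j\<bar>) ` UNIV" by auto
  show "max_norm A < e \<longleftrightarrow> (\<forall>i j. \<bar>A $ i $ j\<bar> < e)" "max_norm A \<le> e \<longleftrightarrow> (\<forall>i j. \<bar>A $ i $ j\<bar> \<le> e)"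
    unfolding max_norm_def * by (subst Max_less_iff Max_le_iff; auto)+
qed

lemma entry_le_max_norm: "\<bar>A $ i $ j\<bar> \<le> max_norm A"
  using max_norm_le_iff [of A "max_norm A"] by simp

lemma max_norm_Gamma_ge_1:
  fixes \<gamma> :: "real ^ 'n ^ 'n"
  assumes "\<gamma> \<in> Gamma_semigroup"
  shows "1 \<le> max_norm \<gamma>"
proof -
  have "\<gamma> \<noteq> 0" using assms det_scaleR [of 0 "mat 1 :: real ^ 'n ^ 'n"]
    by (auto simp: Gamma_semigroup_def power_0_left)
  then obtain i j where ij: "\<gamma> $ i $ j \<noteq> 0" by (auto simp: vec_eq_iff)
  have "\<gamma> $ i $ j \<in> \<int>" using assms by (simp add: Gamma_semigroup_def)
  with ij have "1 \<le> \<bar>\<gamma> $ i $ j\<bar>" by (metis Ints_nonzero_abs_ge1)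
  then show ?thesis using entry_le_max_norm [of \<gamma> i j] by linarith
qed

lemma finite_Gamma_max_norm_le:
  "finite {\<gamma> :: real ^ 'n ^ 'n. \<gamma> \<in> Gamma_semigroup \<and> max_norm \<gamma> \<le> R}"
proof -
  let ?F = "(UNIV :: 'n set) \<rightarrow>\<^sub>E ((UNIV :: 'n set) \<rightarrow>\<^sub>E {- \<lceil>R\<rceil>..\<lceil>R\<rceil>})"
  have "{\<gamma> :: real ^ 'n ^ 'n. \<gamma> \<in> Gamma_semigroup \<and> max_norm \<gamma> \<le> R} \<subseteq> (\<lambda>f. \<chi> i j. of_int (f i j)) ` ?F"
  proof
    fix \<gamma> :: "real ^ 'n ^ 'n" assume \<gamma>: "\<gamma> \<in> {\<gamma>. \<gamma> \<in> Gamma_semigroup \<and> max_norm \<gamma> \<le> R}"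
    have int: "of_int \<lfloor>\<gamma> $ i $ j\<rfloor> = \<gamma> $ i $ j" for i j
      using \<gamma> by (auto simp: Gamma_semigroup_def)
    have "\<bar>\<lfloor>\<gamma> $ i $ j\<rfloor>\<bar> \<le> \<lceil>R\<rceil>" for i j
    proof -
      have "of_int \<bar>\<lfloor>\<gamma> $ i $ j\<rfloor>\<bar> = \<bar>\<gamma> $ i $ j\<bar>" by (simp add: int)
      also have "\<dots> \<le> R" using \<gamma> entry_le_max_norm [of \<gamma> i j] by auto
      also have "\<dots> \<le> of_int \<lceil>R\<rceil>" by (rule le_of_int_ceiling)
      finally show ?thesis by (simp only: of_int_le_iff)
    qed
    then have "(\<lambda>i j. \<lfloor>\<gamma> $ i $ j\<rfloor>) \<in> ?F"
      by (auto simp: abs_le_iff minus_le_iff)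
    then show "\<gamma> \<in> (\<lambda>f. \<chi> i j. of_int (f i j)) ` ?F"
      by (rule rev_image_eqI) (simp add: vec_eq_iff int)
  qed
  then show ?thesis by (rule finite_subset) (intro finite_imageI finite_PiE, auto)
qed

definition approximants :: "real \<Rightarrow> real ^ 'p ^ 'n \<Rightarrow> real ^ 'p ^ 'n \<Rightarrow> (real ^ 'n ^ 'n) set" where
  "approximants \<mu> x y =
     {\<gamma> \<in> Gamma_semigroup. max_norm (\<gamma> ** x - y) < 1 / max_norm \<gamma> powr \<mu>}"

lemma approx_exponent_eq: "approx_exponent x y = Sup {ereal \<mu> | \<mu>. infinite (approximants \<mu> x y)}"
  by (simp add: approx_exponent_def approximants_def)

text \<open>Norms on \<open>Gamma_semigroup\<close> are at least 1, so raising the exponent only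
  tightens the condition.\<close>

lemma approximants_antimono:
  assumes "\<mu> \<le> \<nu>" shows "approximants \<nu> x y \<subseteq> approximants \<mu> x y"
proof
  fix \<gamma> assume \<gamma>: "\<gamma> \<in> approximants \<nu> x y"
  then have 1: "1 \<le> max_norm \<gamma>" by (auto simp: approximants_def max_norm_Gamma_ge_1)
  then have "max_norm \<gamma> powr \<mu> \<le> max_norm \<gamma> powr \<nu>" using assms by (intro powr_mono)
  then have "1 / max_norm \<gamma> powr \<nu> \<le> 1 / max_norm \<gamma> powr \<mu>"
    using 1 by (intro divide_left_mono) auto
  then show "\<gamma> \<in> approximants \<mu> x y"
    using \<gamma> by (auto simp: approximants_def)
qed

context row_selection
begin

text \<open>The selected rows are overwritten by the identity block, not divided by the old block,
  so the random free rows stay untouched. The actual change of coordinates is undone later by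
  \<open>rescale\<close>.\<close>

definition normal :: "real ^ 'p ^ 'n \<Rightarrow> real ^ 'p ^ 'n" where
  "normal x = (\<chi> a. if a \<in> free_rows then x $ a else axis (inv \<iota> a) 1)"

lemma sum_rows: "(\<Sum>k\<in>UNIV. f k) = (\<Sum>j\<in>UNIV. f (\<iota> j)) + (\<Sum>a\<in>free_rows. f a :: real)"
proof -
  have "(\<Sum>k\<in>UNIV. f k) = (\<Sum>k\<in>range \<iota> \<union> free_rows. f k)"
    by (simp add: free_rows_def)
  also have "\<dots> = (\<Sum>k\<in>range \<iota>. f k) + (\<Sum>k\<in>free_rows. f k)"
    by (rule sum.union_disjoint) (auto simp: free_rows_def)
  also have "(\<Sum>k\<in>range \<iota>. f k) = (\<Sum>j\<in>UNIV. f (\<iota> j))"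
    using inj by (simp add: sum.reindex)
  finally show ?thesis .
qed

lemma iota_not_free [simp]: "\<iota> j \<notin> free_rows"
  by (simp add: free_rows_def)

lemma not_free_iff: "b \<notin> free_rows \<longleftrightarrow> (\<exists>j. b = \<iota> j)"
  by (auto simp: free_rows_def)

lemma matrix_mult_normal:
  "(\<gamma> ** normal x) $ i $ j = \<gamma> $ i $ \<iota> j + (\<Sum>a\<in>free_rows. \<gamma> $ i $ a * x $ a $ j)"
proof -
  have "(\<Sum>j'\<in>UNIV. \<gamma> $ i $ \<iota> j' * axis j' 1 $ j) = (\<Sum>j'\<in>UNIV. if j' = j then \<gamma> $ i $ \<iota> j else 0)"
    by (intro sum.cong) (auto simp: axis_def)
  then show ?thesis
    unfolding matrix_matrix_mult_def
    using inj by (simp add: sum_rows normal_def)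
qed

lemma matrix_mult_normal_diff:
  assumes "\<And>a. a \<in> free_rows \<Longrightarrow> \<gamma> $ i $ a = of_int (q a)"
  shows "(\<gamma> ** normal x - y) $ i $ j = \<gamma> $ i $ \<iota> j + row_map q i (x, y) $ j"
  using assms by (simp add: matrix_mult_normal row_map_def)

text \<open>An approximant of norm about \<open>2 ^ k\<close> yields in row \<open>i\<close> a
  vector \<open>q\<close> bounded by \<open>2 ^ k\<close> whose \<open>row_map\<close> is within
  \<open>2 powr (- \<nu> * k)\<close> of an integer vector. For large \<open>k\<close> this is
  excluded by \<open>AE_row_map_misses\<close>.\<close>

lemma AE_finite_approximants:
  assumes \<mu>: "\<mu> * real CARD('p) > real CARD('n) - real CARD('p)"
  shows "AE u in lborel. finite (approximants \<mu> (normal (fst u)) (snd u))"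
proof -
  \<comment> \<open>The midpoint of the critical exponent and \<mu>. The gap to \<mu> pays for a
    norm as small as \<open>2 powr (k - 1)\<close> at scale \<open>k\<close>.\<close>
  define \<nu> where "\<nu> = (\<mu> + (real CARD('n) - real CARD('p)) / real CARD('p)) / 2"
  have \<nu>: "\<nu> * real CARD('p) > real CARD('n) - real CARD('p)" "\<nu> < \<mu>"
  proof -
    have "\<nu> * real CARD('p) = (\<mu> * real CARD('p) + (real CARD('n) - real CARD('p))) / 2"
      by (simp add: \<nu>_def field_simps)
    moreover have "c < (b + c) / 2" if "c < b" for b c :: real using that by simp
    ultimately show "\<nu> * real CARD('p) > real CARD('n) - real CARD('p)" using \<mu> by metis
    have "(real CARD('n) - real CARD('p)) / real CARD('p) < \<mu>"
      using \<mu> by (subst pos_divide_less_eq) auto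
    then show "\<nu> < \<mu>" by (simp add: \<nu>_def)
  qed
  have "0 < \<nu> * real CARD('p)" using \<nu>(1) card_less by linarith
  then have pos: "0 < \<nu>" by (simp add: zero_less_mult_iff)
  \<comment> \<open>For the upper bound a single row suffices.\<close>
  obtain i :: 'n where True by blast
  show ?thesis using AE_row_map_misses [OF \<nu>(1), of i]
  proof (rule AE_mp, intro AE_I2 impI)
    fix u :: "(real ^ 'p ^ 'n) \<times> (real ^ 'p ^ 'n)"
    obtain x y where u: "u = (x, y)" by (cases u)
    assume "eventually (\<lambda>k. \<forall>q. (\<forall>a\<in>free_rows. \<bar>q a\<bar> \<le> 2 ^ k) \<longrightarrow>
           \<not> (\<forall>j. frac (row_map q i u $ j + 2 powr (- \<nu> * k)) < 2 * 2 powr (- \<nu> * k))) sequentially"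
    moreover have "eventually (\<lambda>k. (real k - 1) * \<mu> \<ge> k * \<nu>) sequentially"
      using \<nu>(2) by real_asymp
    ultimately have "eventually (\<lambda>k. (\<forall>q. (\<forall>a\<in>free_rows. \<bar>q a\<bar> \<le> 2 ^ k) \<longrightarrow>
           \<not> (\<forall>j. frac (row_map q i u $ j + 2 powr (- \<nu> * k)) < 2 * 2 powr (- \<nu> * k))) \<and>
           (real k - 1) * \<mu> \<ge> k * \<nu>) sequentially"
      by (rule eventually_conj)
    then obtain K where
      miss: "\<And>k q. K \<le> k \<Longrightarrow> (\<forall>a\<in>free_rows. \<bar>q a\<bar> \<le> 2 ^ k) \<Longrightarrow>
           \<not> (\<forall>j. frac (row_map q i u $ j + 2 powr (- \<nu> * k)) < 2 * 2 powr (- \<nu> * k))"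
      and exps: "\<And>k. K \<le> k \<Longrightarrow> (real k - 1) * \<mu> \<ge> k * \<nu>"
      unfolding eventually_sequentially by blast
    \<comment> \<open>Bounded norm is enough, as only finitely many integer matrices satisfy such a
      bound.\<close>
    have "approximants \<mu> (normal x) y \<subseteq> {\<gamma>. \<gamma> \<in> Gamma_semigroup \<and> max_norm \<gamma> \<le> 2 ^ K}"
    proof (rule ccontr)
      assume "\<not> ?thesis"
      then obtain \<gamma> where \<gamma>: "\<gamma> \<in> Gamma_semigroup"
          and close: "max_norm (\<gamma> ** normal x - y) < 1 / max_norm \<gamma> powr \<mu>"
          and big: "\<not> max_norm \<gamma> \<le> 2 ^ K"
        by (auto simp: approximants_def)
      define T where "T = max_norm \<gamma>"
      have T1: "1 \<le> T" unfolding T_def by (rule max_norm_Gamma_ge_1) fact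
      \<comment> \<open>The dyadic scale of \<gamma>:
        \<open>2 powr (k - 1) \<le> T \<le> 2 ^ k\<close>.\<close>
      define k where "k = nat \<lfloor>log 2 T\<rfloor> + 1"
      have k: "real k - 1 \<le> log 2 T" "log 2 T \<le> real k"
        using T1 by (auto simp: k_def) linarith+
      have Tk: "2 powr (real k - 1) \<le> T" "T \<le> 2 ^ k"
        using k T1 by (auto simp: le_log_iff log_le_iff powr_realpow)
      then have "2 ^ K < (2::real) ^ k" using big unfolding T_def by linarith
      then have Kk: "K \<le> k" by simp
      define \<delta> where "\<delta> = 2 powr (- \<nu> * k)"
      define q where "q a = \<lfloor>\<gamma> $ i $ a\<rfloor>" for a
      have int: "\<gamma> $ i $ a = of_int (q a)" for a
        using \<gamma> by (auto simp: Gamma_semigroup_def q_def)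
      have "\<bar>q a\<bar> \<le> 2 ^ k" for a
      proof -
        have "of_int \<bar>q a\<bar> \<le> (2::real) ^ k"
          using entry_le_max_norm [of \<gamma> i a] Tk(2) by (simp add: int T_def)
        then show ?thesis by (metis of_int_le_iff of_int_numeral of_int_power)
      qed
      moreover have "frac (row_map q i u $ j + \<delta>) < 2 * \<delta>" for j
      proof -
        have "\<bar>(\<gamma> ** normal x - y) $ i $ j\<bar> < 1 / T powr \<mu>"
          using close by (simp add: max_norm_less_iff T_def del: vector_minus_component)
        also have "\<dots> \<le> 1 / (2 powr (real k - 1)) powr \<mu>"
          using Tk(1) pos \<nu>(2) T1 by (intro divide_left_mono powr_mono2) auto
        also have "\<dots> = 2 powr (- ((real k - 1) * \<mu>))"
          by (simp add: powr_powr powr_minus divide_inverse)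
        also have "\<dots> \<le> \<delta>"
          unfolding \<delta>_def using exps [OF Kk] by (simp add: mult.commute)
        finally have *: "\<bar>of_int (q (\<iota> j)) + row_map q i u $ j\<bar> < \<delta>"
          by (simp add: matrix_mult_normal_diff [of \<gamma> i q, OF int] u int [symmetric] del:
              vector_minus_component)
        have frac_le: "frac t \<le> t" if "0 \<le> t" for t :: real
          using that by (simp add: frac_def)
        \<comment> \<open>Adding the integer \<open>q (\<iota> j)\<close> leaves the fractional part
          unchanged and brings the argument into the interval from 0 to
          \<open>2 * \<delta>\<close>.\<close>
        have "frac (row_map q i u $ j + \<delta>) = frac ((row_map q i u $ j + \<delta>) + of_int (q (\<iota> j)))"
          by (simp add: frac_add_Ints)
        also have "\<dots> \<le> (row_map q i u $ j + \<delta>) + of_int (q (\<iota> j))"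
          using * by (intro frac_le) linarith
        also have "\<dots> < 2 * \<delta>" using * by linarith
        finally show ?thesis .
      qed
      ultimately show False using miss [OF Kk, of q] by (simp add: \<delta>_def)
    qed
    then show "finite (approximants \<mu> (normal (fst u)) (snd u))"
      unfolding u fst_conv snd_conv by (rule finite_subset [OF _ finite_Gamma_max_norm_le])
  qed
qed

end

section \<open>The lower bound\<close>

lemma tendsto_det:
  fixes A :: "nat \<Rightarrow> real ^ 'n ^ 'n"
  assumes "\<And>i j. (\<lambda>k. A k $ i $ j) \<longlonglongrightarrow> B $ i $ j"
  shows "(\<lambda>k. det (A k)) \<longlonglongrightarrow> det B"
  unfolding det_def by (intro tendsto_intros assms)

lemma invertible_if_mult_vec_zero:
  fixes A :: "real ^ 'n ^ 'n"
  assumes "\<And>v. A *v v = 0 \<Longrightarrow> v = 0"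
  shows "det A \<noteq> 0"
  using assms by (metis invertible_det_nz invertible_left_inverse matrix_left_invertible_ker)

section \<open>Bordered matrices and the sign of the determinant\<close>

context row_selection
begin

definition top_block :: "real ^ 'p ^ 'n \<Rightarrow> real ^ 'p ^ 'p" where
  "top_block x = (\<chi> j. x $ \<iota> j)"

text \<open>Completes \<open>x\<close> to a square matrix by unit vectors in the free columns. Thus
  \<open>\<gamma> ** border x\<close> displays the columns of \<open>\<gamma> ** x\<close> beside
  the free columns of \<gamma>.\<close>

definition border :: "real ^ 'p ^ 'n \<Rightarrow> real ^ 'n ^ 'n" where
  "border x = (\<chi> i b. if b \<in> free_rows then (if i = b then 1 else 0) else x $ i $ inv \<iota> b)"

lemma border_free: "b \<in> free_rows \<Longrightarrow> border x $ i $ b = (if i = b then 1 else 0)"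
  and border_iota: "border x $ i $ \<iota> j = x $ i $ j"
  using inj by (simp_all add: border_def)

text \<open>In the selected rows the free columns vanish, so \<open>top_block x\<close> kills the
  selected coordinates of a kernel vector. The free rows then give the remaining
  coordinates.\<close>

lemma det_border_nonzero:
  assumes "det (top_block x) \<noteq> 0"
  shows "det (border x) \<noteq> 0"
proof (rule invertible_if_mult_vec_zero)
  fix v assume v: "border x *v v = 0"
  have row: "(\<Sum>j\<in>UNIV. x $ i $ j * v $ \<iota> j) + (\<Sum>a\<in>free_rows. (if i = a then v $ a else 0)) = 0" for i
  proof -
    have "(\<Sum>k\<in>UNIV. border x $ i $ k * v $ k) = 0"
      using v by (simp add: matrix_vector_mult_def vec_eq_iff)
    moreover have "(\<Sum>a\<in>free_rows. border x $ i $ a * v $ a) = (\<Sum>a\<in>free_rows. (if i = a then v $ a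
        else 0))"
      by (intro sum.cong) (auto simp: border_free)
    ultimately show ?thesis by (simp add: sum_rows border_iota)
  qed
  have "top_block x *v (\<chi> j. v $ \<iota> j) = 0"
    using row [of "\<iota> _"] by (simp add: matrix_vector_mult_def vec_eq_iff top_block_def)
  then have "(\<chi> j. v $ \<iota> j) = 0"
    using assms by (metis invertible_det_nz invertible_left_inverse matrix_left_invertible_ker)
  then have iota: "v $ \<iota> j = 0" for j by (simp add: vec_eq_iff)
  moreover have "v $ b = 0" if "b \<in> free_rows" for b
    using row [of b] that by (simp add: iota)
  ultimately show "v = 0"
    unfolding vec_eq_iff using not_free_iff by (metis zero_index)
qed

text \<open>\<open>a\<^sub>0\<close> is the free column whose sign \<open>s\<close> steers the sign of the determinant.\<close>

definition signs :: "'n \<Rightarrow> int \<Rightarrow> real ^ 'n ^ 'n" where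
  "signs a\<^sub>0 s = (\<chi> i b. if i = b then (if b = a\<^sub>0 then of_int s else 1) else 0)"

lemma det_signs: "det (signs a\<^sub>0 s) = of_int s"
proof -
  have "det (signs a\<^sub>0 s) = (\<Prod>i\<in>UNIV. signs a\<^sub>0 s $ i $ i)"
    by (rule det_diagonal) (simp add: signs_def)
  also have "\<dots> = (\<Prod>i\<in>UNIV. if i = a\<^sub>0 then of_int s else 1)"
    by (simp add: signs_def)
  finally show ?thesis by simp
qed

lemma mult_signs: "(A ** signs a\<^sub>0 s) $ i $ b = A $ i $ b * (if b = a\<^sub>0 then of_int s else 1)"
proof -
  have "(A ** signs a\<^sub>0 s) $ i $ b = (\<Sum>k\<in>UNIV. if k = b then A $ i $ b * (if b = a\<^sub>0 then of_int s
      else 1) else 0)"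
    unfolding matrix_matrix_mult_def vec_lambda_beta signs_def by (intro sum.cong) auto
  then show ?thesis by simp
qed

text \<open>With \<open>c = 1 / R k\<close> it makes the growing free columns converge and keeps the
  other columns.\<close>

definition free_scale :: "real \<Rightarrow> real ^ 'n ^ 'n" where
  "free_scale c = (\<chi> i b. if i = b then (if b \<in> free_rows then c else 1) else 0)"

lemma det_free_scale: "det (free_scale c) = c ^ card free_rows"
proof -
  have "det (free_scale c) = (\<Prod>i\<in>UNIV. free_scale c $ i $ i)"
    by (rule det_diagonal) (simp add: free_scale_def)
  also have "\<dots> = (\<Prod>i\<in>UNIV. if i \<in> free_rows then c else 1)"
    by (simp add: free_scale_def)
  also have "\<dots> = c ^ card free_rows" by (subst prod.If_cases) auto
  finally show ?thesis .
qed

lemma mult_free_scale: "(A ** free_scale c) $ i $ b = A $ i $ b * (if b \<in> free_rows then c else 1)"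
proof -
  have "(A ** free_scale c) $ i $ b = (\<Sum>k\<in>UNIV. if k = b then A $ i $ b * (if b \<in> free_rows then c
      else 1) else 0)"
    unfolding matrix_matrix_mult_def vec_lambda_beta free_scale_def by (intro sum.cong) auto
  then show ?thesis by simp
qed

lemma mult_border_free: "b \<in> free_rows \<Longrightarrow> (\<gamma> ** border x) $ i $ b = \<gamma> $ i $ b"
proof -
  assume b: "b \<in> free_rows"
  have "(\<gamma> ** border x) $ i $ b = (\<Sum>k\<in>UNIV. if k = b then \<gamma> $ i $ b else 0)"
    unfolding matrix_matrix_mult_def vec_lambda_beta using b by (intro sum.cong) (auto simp:
        border_free)
  then show ?thesis by simp
qed

lemma mult_border_iota: "(\<gamma> ** border x) $ i $ \<iota> j = (\<gamma> ** x) $ i $ j"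
  by (simp add: matrix_matrix_mult_def border_iota)

lemma top_normal: "top_block (normal x) = mat 1"
  using inj by (auto simp: top_block_def normal_def vec_eq_iff axis_def mat_def)

text \<open>\<gamma> is assembled row by row from hitting vectors \<open>q\<close>. Their boxes sit
  at \<open>k * 2 ^ k\<close> times a signed diagonal matrix: the factor \<open>k\<close> makes the
  side \<open>2 ^ k\<close> negligible, so the sign of the determinant is controlled, and its cost
  in the norm is absorbed by \<open>\<mu> < \<nu>\<close>.\<close>

lemma infinite_approximants_if_row_hits:
  fixes x y :: "real ^ 'p ^ 'n" and \<mu> \<nu> :: real
  assumes \<mu>: "0 < \<mu>" "\<mu> < \<nu>" and y: "det (top_block y) \<noteq> 0" and a\<^sub>0: "a\<^sub>0 \<in> free_rows"
    and hits: "\<And>i s. s \<in> {1, -1} \<Longrightarrow> eventually (\<lambda>k::nat.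
      \<exists>q \<in> (\<Pi>\<^sub>E a\<in>free_rows. {int k * 2 ^ k * (if i = a then if a = a\<^sub>0 then s else 1 else 0) ..<
                int k * 2 ^ k * (if i = a then if a = a\<^sub>0 then s else 1 else 0) + 2 ^ k}).
        \<forall>j. frac (row_map q i (x, y) $ j) < 2 powr (- \<nu> * k)) sequentially"
  shows "infinite (approximants \<mu> (normal x) y)"
proof -
  let ?U = "border (normal x)"
  define R where "R k = real k * 2 ^ k" for k :: nat
  have detU: "det ?U \<noteq> 0" by (rule det_border_nonzero) (simp add: top_normal)
  have "det (border y) \<noteq> 0" by (rule det_border_nonzero) fact
  \<comment> \<open>The required sign depends on the pair \<open>(x, y)\<close>; it makes the limit
    of the rescaled determinants agree in sign with \<open>det ?U\<close>.\<close>
  then obtain s :: int where s: "s \<in> {1, -1}" and sgn: "det (border y ** signs a\<^sub>0 s) * det ?U > 0"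
  proof -
    have "det (border y) * det ?U \<noteq> 0" using detU \<open>det (border y) \<noteq> 0\<close> by simp
    then consider "det (border y) * det ?U > 0" | "det (border y) * det ?U < 0" by linarith
    then show ?thesis
      by cases (rule that [of 1] that [of "-1"]; simp add: det_mul det_signs)+
  qed
  define Z where "Z i a = (if i = a then if a = a\<^sub>0 then s else 1 else 0)" for i a
  define H where "H k i q \<longleftrightarrow>
      q \<in> (\<Pi>\<^sub>E a\<in>free_rows. {int k * 2 ^ k * Z i a ..< int k * 2 ^ k * Z i a + 2 ^ k}) \<and>
      (\<forall>j. frac (row_map q i (x, y) $ j) < 2 powr (- \<nu> * k))" for k :: nat and i q
  have "eventually (\<lambda>k. \<forall>i. \<exists>q. H k i q) sequentially"
    by (rule eventually_all_finite) (use hits [OF s] in \<open>simp add: H_def Z_def Bex_def\<close>)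
  then obtain K where "\<forall>k\<ge>K. \<forall>i. \<exists>q. H k i q"
    unfolding eventually_sequentially by blast
  then obtain q where H: "\<And>k i. K \<le> k \<Longrightarrow> H k i (q k i)"
    by metis
  then have q: "\<And>k i. K \<le> k \<Longrightarrow>
        q k i \<in> (\<Pi>\<^sub>E a\<in>free_rows. {int k * 2 ^ k * Z i a ..< int k * 2 ^ k * Z i a + 2 ^ k})"
      and close: "\<And>k i j. K \<le> k \<Longrightarrow> frac (row_map (q k i) i (x, y) $ j) < 2 powr (- \<nu> * k)"
    unfolding H_def by blast+
  \<comment> \<open>The selected entries are negated floors, so each entry of
    \<open>\<gamma> k ** normal x - y\<close> becomes a fractional part.\<close>
  define \<gamma> :: "nat \<Rightarrow> real ^ 'n ^ 'n" where "\<gamma> k = (\<chi> i b. if b \<in> free_rows then of_int (q k i b)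
      else - of_int \<lfloor>row_map (q k i) i (x, y) $ inv \<iota> b\<rfloor>)" for k
  have free: "\<gamma> k $ i $ b = of_int (q k i b)" if "b \<in> free_rows" for k i b
    using that by (simp add: \<gamma>_def)
  have int: "\<gamma> k $ i $ b \<in> \<int>" for k i b
    by (simp add: \<gamma>_def)
  have diff: "(\<gamma> k ** normal x - y) $ i $ j = frac (row_map (q k i) i (x, y) $ j)" for k i j
    using inj by (subst matrix_mult_normal_diff [where q = "q k i"]) (simp_all add: free, simp add:
        \<gamma>_def frac_def)
  have Zb: "R k * Z i b \<le> \<gamma> k $ i $ b" "\<gamma> k $ i $ b \<le> R k * Z i b + 2 ^ k"
    if "K \<le> k" "b \<in> free_rows" for k i b
  proof -
    have "q k i b \<in> {int k * 2 ^ k * Z i b ..< int k * 2 ^ k * Z i b + 2 ^ k}"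
      using q [OF that(1), of i] that(2) by (auto simp: PiE_def Pi_def)
    then have "real_of_int (int k * 2 ^ k * Z i b) \<le> of_int (q k i b)"
        "of_int (q k i b) \<le> real_of_int (int k * 2 ^ k * Z i b + 2 ^ k)"
      by (simp_all only: of_int_le_iff) auto
    then show "R k * Z i b \<le> \<gamma> k $ i $ b" "\<gamma> k $ i $ b \<le> R k * Z i b + 2 ^ k"
      using that(2) by (simp_all add: free R_def)
  qed
  have lim_free: "(\<lambda>k. \<gamma> k $ i $ b / R k) \<longlonglongrightarrow> Z i b" if b: "b \<in> free_rows" for i b
  proof (rule tendsto_sandwich)
    show "eventually (\<lambda>k. real_of_int (Z i b) \<le> \<gamma> k $ i $ b / R k) sequentially"
      using eventually_ge_at_top [of K] eventually_gt_at_top [of 0]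
    proof eventually_elim
      case (elim k)
      then have "R k > 0" by (simp add: R_def)
      then show ?case using Zb(1) [OF elim(1) b] by (simp add: pos_le_divide_eq mult.commute)
    qed
    show "eventually (\<lambda>k. \<gamma> k $ i $ b / R k \<le> Z i b + 1 / real k) sequentially"
      using eventually_ge_at_top [of K] eventually_gt_at_top [of 0]
    proof eventually_elim
      case (elim k)
      then have "R k > 0" and "2 ^ k = R k * (1 / real k)" by (simp_all add: R_def)
      then show ?case using Zb(2) [OF elim(1) b, of i] by (simp add: pos_divide_le_eq algebra_simps)
    qed
    show "(\<lambda>k. real_of_int (Z i b) + 1 / real k) \<longlonglongrightarrow> of_int (Z i b)" by real_asymp
  qed simp
  have frac0: "(\<lambda>k. frac (row_map (q k i) i (x, y) $ j)) \<longlonglongrightarrow> 0" for i j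
  proof (rule tendsto_sandwich [of "\<lambda>_. 0"])
    show "eventually (\<lambda>k. frac (row_map (q k i) i (x, y) $ j) \<le> 2 powr (- \<nu> * real k)) sequentially"
      using eventually_ge_at_top [of K] by eventually_elim (use close in \<open>auto simp: less_imp_le\<close>)
    show "(\<lambda>k. 2 powr (- \<nu> * real k)) \<longlonglongrightarrow> 0" using \<mu> by real_asymp
  qed auto
  have lim_y: "(\<lambda>k. (\<gamma> k ** normal x) $ i $ j) \<longlonglongrightarrow> y $ i $ j" for i j
  proof -
    have "(\<gamma> k ** normal x) $ i $ j = y $ i $ j + frac (row_map (q k i) i (x, y) $ j)" for k
      using diff [of k i j] by simp
    then show ?thesis using tendsto_add [OF tendsto_const frac0, of "y $ i $ j" i j] by simp
  qed
  have R: "filterlim R at_top sequentially" unfolding R_def by real_asymp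

  txt \<open>\<open>\<gamma> ** ?U\<close> has the columns of \<open>\<gamma> ** normal x\<close>, which tend to those of \<open>y\<close>, and the free
    columns of \<open>\<gamma>\<close>, which grow like \<open>R * Z\<close>.\<close>
  have "(\<lambda>k. det (\<gamma> k ** ?U ** free_scale (1 / R k))) \<longlonglongrightarrow> det (border y ** signs a\<^sub>0 s)"
  proof (rule tendsto_det)
    fix i b
    show "(\<lambda>k. (\<gamma> k ** ?U ** free_scale (1 / R k)) $ i $ b) \<longlonglongrightarrow> (border y ** signs a\<^sub>0 s) $ i $ b"
    proof (cases "b \<in> free_rows")
      case True
      then have "(border y ** signs a\<^sub>0 s) $ i $ b = Z i b"
        by (simp add: mult_signs border_free Z_def)
      then show ?thesis
        using lim_free [OF True, of i] True by (simp add: mult_free_scale mult_border_free)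
    next
      case False
      then obtain j where j: "b = \<iota> j" by (auto simp: not_free_iff)
      have "b \<noteq> a\<^sub>0" using False a\<^sub>0 by blast
      then show ?thesis
        using lim_y [of i j] False by (simp add: mult_free_scale mult_border_iota mult_signs
            border_iota j)
    qed
  qed
  \<comment> \<open>Multiplying by \<open>det ?U\<close> produces its square times
    \<open>det (\<gamma> k)\<close> and a positive scaling factor, which isolates the sign of
    \<open>det (\<gamma> k)\<close>.\<close>
  then have "(\<lambda>k. det (\<gamma> k ** ?U ** free_scale (1 / R k)) * det ?U) \<longlonglongrightarrow> det (border y ** signs a\<^sub>0 s)
      * det ?U"
    by (intro tendsto_intros)
  then have "eventually (\<lambda>k. det (\<gamma> k ** ?U ** free_scale (1 / R k)) * det ?U > 0) sequentially"
    using sgn by (rule order_tendstoD)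
  then have detpos: "eventually (\<lambda>k. det (\<gamma> k) > 0) sequentially"
    using eventually_gt_at_top [of 0]
  proof eventually_elim
    case (elim k)
    have "0 < det (\<gamma> k) * ((1 / R k) ^ card free_rows * (det ?U)\<^sup>2)"
      using elim(1) by (simp add: det_mul det_free_scale power2_eq_square mult_ac)
    moreover have "0 \<le> (1 / R k) ^ card free_rows * (det ?U)\<^sup>2" by (simp add: R_def)
    ultimately show ?case by (meson mult_nonpos_nonneg not_le)
  qed

  \<comment> \<open>All entries are of order at most \<open>R k\<close>: the free ones by their
    limits, the selected ones as an entry of \<open>\<gamma> k ** normal x\<close> minus a
    combination of free ones.\<close>
  obtain C where C: "0 < C" "eventually (\<lambda>k. max_norm (\<gamma> k) \<le> C * R k) sequentially"
  proof -
    have "Bseq (\<lambda>k. \<gamma> k $ i $ b / R k)" for i b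
    proof (cases "b \<in> free_rows")
      case True
      then show ?thesis using lim_free by (intro convergent_imp_Bseq convergentI)
    next
      case False
      then obtain j where j: "b = \<iota> j" by (auto simp: not_free_iff)
      have "(\<lambda>k. (\<gamma> k ** normal x) $ i $ j * (1 / R k) - (\<Sum>a\<in>free_rows. \<gamma> k $ i $ a / R k * x $ a $ j))
          \<longlonglongrightarrow> y $ i $ j * 0 - (\<Sum>a\<in>free_rows. Z i a * x $ a $ j)"
        by (intro tendsto_intros lim_y lim_free real_tendsto_divide_at_top [OF tendsto_const R])
      also have "(\<lambda>k. (\<gamma> k ** normal x) $ i $ j * (1 / R k) - (\<Sum>a\<in>free_rows. \<gamma> k $ i $ a / R k * x
          $ a $ j))
          = (\<lambda>k. \<gamma> k $ i $ b / R k)"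
        by (simp add: matrix_mult_normal j add_divide_distrib sum_divide_distrib)
      finally show ?thesis by (intro convergent_imp_Bseq convergentI)
    qed
    then have "\<forall>i b. \<exists>c>0. \<forall>k. \<bar>\<gamma> k $ i $ b / R k\<bar> \<le> c"
      by (simp add: Bseq_def)
    then obtain c where c: "\<And>i b. c i b > 0" "\<And>i b k. \<bar>\<gamma> k $ i $ b / R k\<bar> \<le> c i b"
      by metis
    define C where "C = (\<Sum>i\<in>UNIV. \<Sum>b\<in>UNIV. c i b)"
    have cC: "c i b \<le> C" for i b
    proof -
      have "c i b \<le> (\<Sum>b\<in>UNIV. c i b)" using c(1) by (intro member_le_sum) (auto simp: less_imp_le)
      also have "\<dots> \<le> C" unfolding C_def
        using c(1) by (intro member_le_sum [of i UNIV "\<lambda>i. \<Sum>b\<in>UNIV. c i b"]) (auto simp: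
            less_imp_le intro!: sum_nonneg)
      finally show ?thesis .
    qed
    show ?thesis
    proof
      show "0 < C" using c(1) cC by (meson less_le_trans)
      show "eventually (\<lambda>k. max_norm (\<gamma> k) \<le> C * R k) sequentially"
        using eventually_gt_at_top [of 0]
      proof eventually_elim
        case (elim k)
        then have Rk: "R k > 0" by (simp add: R_def)
        have "\<bar>\<gamma> k $ i $ b\<bar> \<le> C * R k" for i b
          using c(2) [of k i b] cC [of i b] Rk by (simp add: abs_divide pos_divide_le_eq [symmetric])
        then show ?case by (simp add: max_norm_le_iff)
      qed
    qed
  qed

  \<comment> \<open>Since \<open>\<mu> < \<nu>\<close>, the decay beats both the constant
    \<open>C\<close> and the extra factor \<open>k\<close> in the norm bound.\<close>
  have "eventually (\<lambda>k. 2 powr (- \<nu> * k) \<le> 1 / (C * (real k * 2 ^ k)) powr \<mu>) sequentially"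
    using C(1) \<mu> by real_asymp
  then have "eventually (\<lambda>k. \<gamma> k \<in> approximants \<mu> (normal x) y) sequentially"
    using C(2) detpos eventually_ge_at_top [of K]
  proof eventually_elim
    case (elim k)
    have \<gamma>: "\<gamma> k \<in> Gamma_semigroup" using elim int by (simp add: Gamma_semigroup_def)
    have "\<bar>(\<gamma> k ** normal x - y) $ i $ j\<bar> < 2 powr (- \<nu> * k)" for i j
      unfolding diff using close [OF elim(4)] by simp
    then have "max_norm (\<gamma> k ** normal x - y) < 2 powr (- \<nu> * k)"
      unfolding max_norm_less_iff by blast
    also have "\<dots> \<le> 1 / (C * R k) powr \<mu>" using elim(1) by (simp add: R_def)
    also have "\<dots> \<le> 1 / max_norm (\<gamma> k) powr \<mu>"
    proof -
      have "1 \<le> max_norm (\<gamma> k)" by (rule max_norm_Gamma_ge_1) fact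
      moreover from this have "0 < C * R k" using elim(2) by linarith
      moreover from this have "R k \<noteq> 0" by auto
      ultimately show ?thesis using elim(2) \<mu> C(1) by (intro divide_left_mono powr_mono2) auto
    qed
    finally show ?case using \<gamma> by (simp add: approximants_def)
  qed
  then obtain N where N: "\<And>k. N \<le> k \<Longrightarrow> \<gamma> k \<in> approximants \<mu> (normal x) y"
    unfolding eventually_sequentially by blast
  show ?thesis
  proof
    assume "finite (approximants \<mu> (normal x) y)"
    then have "finite (max_norm ` approximants \<mu> (normal x) y)" by (rule finite_imageI)
    then obtain B where B: "\<And>g. g \<in> approximants \<mu> (normal x) y \<Longrightarrow> max_norm g \<le> B"
      by (metis bdd_above.unfold bdd_above_finite imageI)
    \<comment> \<open>For either sign the diagonal entry at \<open>a\<^sub>0\<close> lies within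
      \<open>2 ^ k\<close> of plus or minus \<open>k * 2 ^ k\<close>, so the norms are unbounded and
      the approximants cannot be finite in number.\<close>
    have "eventually (\<lambda>k. (real k - 1) * 2 ^ k > B) sequentially" by real_asymp
    then have "eventually (\<lambda>k. False) sequentially"
      using eventually_ge_at_top [of K] eventually_ge_at_top [of N]
    proof eventually_elim
      case (elim k)
      have "(real k - 1) * 2 ^ k \<le> \<bar>\<gamma> k $ a\<^sub>0 $ a\<^sub>0\<bar>"
        using Zb [OF elim(2) a\<^sub>0, of a\<^sub>0] s by (auto simp: Z_def R_def algebra_simps)
      also have "\<dots> \<le> B" using entry_le_max_norm B [OF N [OF elim(3)]] by (rule order_trans)
      finally show ?case using elim(1) by simp
    qed
    then show False by simp
  qed
qed

end

section \<open>Reduction to the normalized case\<close>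

lemma max_norm_matrix_mult_le:
  fixes A :: "real ^ 'p ^ 'n" and w :: "real ^ 'q ^ 'p"
  shows "max_norm (A ** w) \<le> real CARD('p) * max_norm w * max_norm A"
  unfolding max_norm_le_iff
proof (intro allI)
  fix i j
  have "\<bar>(A ** w) $ i $ j\<bar> \<le> (\<Sum>k\<in>UNIV. \<bar>A $ i $ k * w $ k $ j\<bar>)"
    unfolding matrix_matrix_mult_def by simp
  also have "\<dots> \<le> (\<Sum>k\<in>(UNIV :: 'p set). max_norm A * max_norm w)"
  proof (rule sum_mono)
    fix k
    show "\<bar>A $ i $ k * w $ k $ j\<bar> \<le> max_norm A * max_norm w"
      unfolding abs_mult by (intro mult_mono entry_le_max_norm) (auto intro: order_trans [OF _
          entry_le_max_norm [of A i k]])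
  qed
  finally show "\<bar>(A ** w) $ i $ j\<bar> \<le> real CARD('p) * max_norm w * max_norm A"
    by (simp add: mult_ac)
qed

text \<open>Multiplication by \<open>w\<close> enlarges the error by at most a constant factor,
  which a power \<open>\<mu> - \<nu>\<close> of the norm absorbs outside a finite set of
  \<gamma>.\<close>

lemma infinite_approximants_mult:
  fixes x y :: "real ^ 'p ^ 'n" and w :: "real ^ 'q ^ 'p"
  assumes inf: "infinite (approximants \<mu> x y)" and less: "\<nu> < \<mu>"
  shows "infinite (approximants \<nu> (x ** w) (y ** w))"
proof -
  \<comment> \<open>The summand 1 keeps \<open>K\<close> positive even for
    \<open>w = 0\<close>.\<close>
  define K where "K = real CARD('p) * max_norm w + 1"
  have "0 \<le> max_norm w" using entry_le_max_norm [of w undefined undefined] by linarith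
  then have K: "1 \<le> K" by (simp add: K_def)
  \<comment> \<open>Solves \<open>R powr (\<mu> - \<nu>) = K\<close>, the threshold beyond which the
    power of the norm dominates \<open>K\<close>.\<close>
  define R where "R = K powr (1 / (\<mu> - \<nu>))"
  have "approximants \<mu> x y - {\<gamma>. \<gamma> \<in> Gamma_semigroup \<and> max_norm \<gamma> \<le> R} \<subseteq> approximants \<nu> (x ** w) (y
      ** w)"
  proof
    fix \<gamma> assume *: "\<gamma> \<in> approximants \<mu> x y - {\<gamma>. \<gamma> \<in> Gamma_semigroup \<and> max_norm \<gamma> \<le> R}"
    then have \<gamma>: "\<gamma> \<in> Gamma_semigroup" and close: "max_norm (\<gamma> ** x - y) < 1 / max_norm \<gamma> powr \<mu>"
      and big: "R < max_norm \<gamma>"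
      by (auto simp: approximants_def)
    have T: "1 \<le> max_norm \<gamma>" by (rule max_norm_Gamma_ge_1) fact
    have "K = R powr (\<mu> - \<nu>)" using K less by (simp add: R_def powr_powr)
    also have "\<dots> \<le> max_norm \<gamma> powr (\<mu> - \<nu>)"
      using big less by (intro powr_mono2) (auto simp: R_def)
    finally have KT: "K \<le> max_norm \<gamma> powr (\<mu> - \<nu>)" .
    have nn: "0 \<le> max_norm (\<gamma> ** x - y)" using entry_le_max_norm [of "\<gamma> ** x - y" undefined
        undefined] by linarith
    have "\<gamma> ** (x ** w) - y ** w = (\<gamma> ** x - y) ** w"
      by (simp add: matrix_mul_assoc) (simp add: matrix_matrix_mult_def vec_eq_iff sum_subtractf
          left_diff_distrib)
    then have "max_norm (\<gamma> ** (x ** w) - y ** w) \<le> K * max_norm (\<gamma> ** x - y)"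
      using max_norm_matrix_mult_le [of "\<gamma> ** x - y" w] nn by (simp add: K_def distrib_right)
    also have "\<dots> < K * (1 / max_norm \<gamma> powr \<mu>)"
      using close K by (intro mult_strict_left_mono) auto
    also have "\<dots> \<le> max_norm \<gamma> powr (\<mu> - \<nu>) * (1 / max_norm \<gamma> powr \<mu>)"
      using KT by (intro mult_right_mono) auto
    also have "\<dots> = 1 / max_norm \<gamma> powr \<nu>"
      using T by (simp add: powr_diff)
    finally show "\<gamma> \<in> approximants \<nu> (x ** w) (y ** w)"
      using \<gamma> by (simp add: approximants_def)
  qed
  moreover have "infinite (approximants \<mu> x y - {\<gamma>. \<gamma> \<in> Gamma_semigroup \<and> max_norm \<gamma> \<le> R})"
    by (rule Diff_infinite_finite [OF finite_Gamma_max_norm_le inf])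
  ultimately show ?thesis by (rule infinite_super)
qed

text \<open>An arbitrarily small loss in the exponent does not affect the supremum.\<close>

lemma approx_exponent_mult_le: "approx_exponent x y \<le> approx_exponent (x ** w) (y ** w)"
  unfolding approx_exponent_eq [of x y]
proof (rule Sup_least, safe)
  fix \<mu> assume inf: "infinite (approximants \<mu> x y)"
  have *: "ereal \<nu> \<le> approx_exponent (x ** w) (y ** w)" if "\<nu> < \<mu>" for \<nu>
    unfolding approx_exponent_eq
    by (rule Sup_upper) (use infinite_approximants_mult [OF inf that] in blast)
  show "ereal \<mu> \<le> approx_exponent (x ** w) (y ** w)"
  proof (rule dense_le)
    fix t assume "t < ereal \<mu>"
    with * show "t \<le> approx_exponent (x ** w) (y ** w)" by (cases t) auto
  qed
qed

text \<open>The reverse inequality comes from multiplying by \<open>w'\<close>.\<close>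

lemma approx_exponent_mult:
  assumes "w ** w' = mat 1"
  shows "approx_exponent (x ** w) (y ** w) = approx_exponent x y"
  using approx_exponent_mult_le [of x y w] approx_exponent_mult_le [of "x ** w" "y ** w" w'] assms
  by (simp add: matrix_mul_assoc [symmetric])

section \<open>Null sets, the normalized exponent and the change of coordinates\<close>

context row_selection
begin

text \<open>Along the direction \<open>v\<close> the determinant has only finitely many zeros, so
  lines in that direction meet the set countably often.\<close>

lemma null_det_top_zero:
  fixes f :: "(real ^ 'p ^ 'n) \<times> (real ^ 'p ^ 'n) \<Rightarrow> real ^ 'p ^ 'n"
  assumes cont: "continuous_on UNIV f" and line: "\<And>u t. top_block (f (u + t *\<^sub>R v)) = top_block (f
      u) + t *\<^sub>R mat 1"
  shows "{u. det (top_block (f u)) = 0} \<in> null_sets lborel"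
proof (rule null_set_if_countable_lines)
  have "closed {u. det (top_block (f u)) = 0}"
    unfolding det_def top_block_def by (intro closed_Collect_eq continuous_intros cont)
  then show "{u. det (top_block (f u)) = 0} \<in> sets borel" by (rule borel_closed)
  show "countable {t. u + t *\<^sub>R v \<in> {u. det (top_block (f u)) = 0}}" for u
    using finite_det_line_zeros [of "top_block (f u)"] by (simp add: line countable_finite)
qed

definition top_unit :: "real ^ 'p ^ 'n" where
  "top_unit = (\<chi> a j. if a = \<iota> j then 1 else 0)"

lemma top_add_unit: "top_block (x + t *\<^sub>R top_unit) = top_block x + t *\<^sub>R mat 1"
  using inj by (auto simp: top_block_def top_unit_def vec_eq_iff mat_def inj_eq)

lemma null_det_top_fst:
  "{u :: (real ^ 'p ^ 'n) \<times> (real ^ 'p ^ 'n). det (top_block (fst u)) = 0} \<in> null_sets lborel"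
  by (rule null_det_top_zero [where v = "(top_unit, 0)"]) (auto simp: top_add_unit intro:
      continuous_intros)

lemma null_det_top_snd:
  "{u :: (real ^ 'p ^ 'n) \<times> (real ^ 'p ^ 'n). det (top_block (snd u)) = 0} \<in> null_sets lborel"
  by (rule null_det_top_zero [where v = "(0, top_unit)"]) (auto simp: top_add_unit intro:
      continuous_intros)

lemma AE_infinite_approximants:
  fixes \<mu> :: real
  assumes \<mu>: "0 < \<mu>" "\<mu> < (real CARD('n) - real CARD('p)) / real CARD('p)"
  shows "AE u in lborel. infinite (approximants \<mu> (normal (fst u)) (snd u))"
proof -
  obtain \<nu> where \<nu>: "\<mu> < \<nu>" "\<nu> < (real CARD('n) - real CARD('p)) / real CARD('p)"
    using \<mu>(2) dense by blast
  then have \<nu>': "0 \<le> \<nu>" "\<nu> * real CARD('p) < real CARD('n) - real CARD('p)"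
    using \<mu>(1) by (auto simp: pos_less_divide_eq)
  obtain a\<^sub>0 where a\<^sub>0: "a\<^sub>0 \<in> free_rows" using ex_free_row by blast
  \<comment> \<open>Both signs and all rows are prepared at once, because the sign needed is known
    only after \<open>u\<close> is.\<close>
  have "AE u in lborel. \<forall>s\<in>{1, -1}. \<forall>i\<in>UNIV. eventually (\<lambda>k::nat.
      \<exists>q \<in> (\<Pi>\<^sub>E a\<in>free_rows. {int k * 2 ^ k * (if i = a then if a = a\<^sub>0 then s else 1 else 0) ..<
                int k * 2 ^ k * (if i = a then if a = a\<^sub>0 then s else 1 else 0) + 2 ^ k}).
        \<forall>j. frac (row_map q i u $ j) < 2 powr (- \<nu> * k)) sequentially"
    by (intro AE_finite_allI AE_row_map_hits [OF \<nu>']) auto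
  moreover note AE_not_in [OF null_det_top_snd]
  ultimately show ?thesis
  proof eventually_elim
    case (elim u)
    show ?case
      by (rule infinite_approximants_if_row_hits [OF \<mu>(1) \<nu>(1) _ a\<^sub>0]) (use elim in auto)
  qed
qed

lemma AE_approx_exponent_normal:
  "AE u in lborel. approx_exponent (normal (fst u)) (snd u) =
     ereal ((real CARD('n) - real CARD('p)) / real CARD('p))"
proof -
  define E where "E = (real CARD('n) - real CARD('p)) / real CARD('p)"
  have E: "0 < E" using card_less by (simp add: E_def)
  \<comment> \<open>Countably many exponents approach \<open>E\<close> from each side. The 2 in the
    denominator keeps \<open>lo 0\<close> positive, as the lower bound demands.\<close>
  define lo where "lo l = E - E / (real l + 2)" for l
  define hi where "hi l = E + 1 / (real l + 1)" for l
  have "AE u in lborel. \<forall>l. finite (approximants (hi l) (normal (fst u)) (snd u))"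
    unfolding AE_all_countable
  proof
    fix l
    have "E < hi l" by (simp add: hi_def)
    then show "AE u in lborel. finite (approximants (hi l) (normal (fst u)) (snd u))"
      by (intro AE_finite_approximants) (simp add: E_def pos_divide_less_eq)
  qed
  moreover have "AE u in lborel. \<forall>l. infinite (approximants (lo l) (normal (fst u)) (snd u))"
    unfolding AE_all_countable
  proof
    fix l
    have "0 < lo l" "lo l < E" using E by (simp_all add: lo_def field_simps add_pos_nonneg)
    then show "AE u in lborel. infinite (approximants (lo l) (normal (fst u)) (snd u))"
      by (intro AE_infinite_approximants) (simp_all add: E_def)
  qed
  ultimately have "AE u in lborel. approx_exponent (normal (fst u)) (snd u) = ereal E"
  proof eventually_elim
    case (elim u)
    show ?case
    proof (rule antisym)
      show "approx_exponent (normal (fst u)) (snd u) \<le> ereal E"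
        unfolding approx_exponent_eq
      proof (rule Sup_least, safe)
        fix \<mu> assume inf: "infinite (approximants \<mu> (normal (fst u)) (snd u))"
        have "\<mu> \<le> hi l" for l
          using elim(1) inf approximants_antimono [of "hi l" \<mu>] by (meson finite_subset linear)
        moreover have "hi \<longlonglongrightarrow> E" unfolding hi_def by real_asymp
        ultimately show "ereal \<mu> \<le> ereal E" by (simp add: LIMSEQ_le_const)
      qed
      have "(\<lambda>l. ereal (lo l)) \<longlonglongrightarrow> ereal E"
        unfolding lo_def by (intro tendsto_ereal) real_asymp
      moreover have "ereal (lo l) \<le> approx_exponent (normal (fst u)) (snd u)" for l
        unfolding approx_exponent_eq by (rule Sup_upper) (use elim(2) in blast)
      ultimately show "ereal E \<le> approx_exponent (normal (fst u)) (snd u)"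
        using LIMSEQ_le_const2 by blast
    qed
  qed
  then show ?thesis by (simp add: E_def)
qed

text \<open>Inverse of the normalization: the selected rows of the first component, which
  \<open>normal\<close> ignores, store the block by which to multiply. The map thus acts between
  spaces of equal dimension.\<close>

definition rescale :: "(real ^ 'p ^ 'n) \<times> (real ^ 'p ^ 'n) \<Rightarrow> (real ^ 'p ^ 'n) \<times> (real ^ 'p ^ 'n)" where
  "rescale u = (normal (fst u) ** top_block (fst u), snd u ** top_block (fst u))"

lemma differentiable_rescale: "rescale differentiable_on S"
proof -
  have entry: "(\<lambda>u. f u $ a $ j) differentiable at u" if "bounded_linear f"
    for f :: "(real ^ 'p ^ 'n) \<times> (real ^ 'p ^ 'n) \<Rightarrow> real ^ 'p ^ 'n" and a j u
    by (intro bounded_linear_imp_differentiable bounded_linear_compose [OF bounded_linear_vec_nth]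
        bounded_linear_compose [OF bounded_linear_vec_nth that])
  have "(\<lambda>u. normal (fst u) $ a $ k) differentiable at u" for a k and u :: "(real ^ 'p ^ 'n) \<times>
      (real ^ 'p ^ 'n)"
    by (cases "a \<in> free_rows") (simp_all add: normal_def entry bounded_linear_fst)
  note entries = this entry [OF bounded_linear_fst] entry [OF bounded_linear_snd]
  have "rescale differentiable at u" for u
    by (subst differentiable_componentwise_within) (auto simp: rescale_def Basis_prod_def
        Basis_vec_def inner_axis matrix_matrix_mult_def top_block_def
        intro!: differentiable_sum differentiable_mult entries)
  then show ?thesis by (simp add: differentiable_at_imp_differentiable_on)
qed

text \<open>The exponent is invariant under right multiplication by an invertible block. A bad pair
  therefore has a singular block or lies in the image under \<open>rescale\<close> of the normalized
  exceptional set.\<close>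

lemma AE_approx_exponent:
  "AE u in (lebesgue :: ((real ^ 'p ^ 'n) \<times> (real ^ 'p ^ 'n)) measure). approx_exponent (fst u)
      (snd u) =
     ereal ((real CARD('n) - real CARD('p)) / real CARD('p))"
proof -
  let ?E = "ereal ((real CARD('n) - real CARD('p)) / real CARD('p))"
  obtain N where N: "N \<in> null_sets lborel" and
    good: "\<And>u. u \<notin> N \<Longrightarrow> approx_exponent (normal (fst u)) (snd u) = ?E"
    using AE_approx_exponent_normal unfolding eventually_ae_filter by auto
  \<comment> \<open>Differentiable maps between spaces of equal dimension preserve negligible sets;
    the image is treated in the completed measure.\<close>
  have "negligible N" using N by (simp add: negligible_iff_null_sets null_sets_completionI)
  then have "negligible (rescale ` N)"
    by (intro negligible_differentiable_image_negligible differentiable_rescale) auto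
  then have null: "rescale ` N \<union> {u. det (top_block (fst u)) = 0} \<in> null_sets lebesgue"
    by (intro null_sets.Un null_sets_completionI [OF null_det_top_fst]) (simp add:
        negligible_iff_null_sets)
  have "approx_exponent (fst u) (snd u) = ?E" if u: "u \<notin> rescale ` N \<union> {u. det (top_block (fst u))
      = 0}" for u
  proof -
    obtain x y where xy: "u = (x, y)" by (cases u)
    let ?w = "top_block x"
    have "det ?w \<noteq> 0" using u xy by simp
    then obtain w' where w': "?w ** w' = mat 1" "w' ** ?w = mat 1"
      by (metis invertible_def invertible_det_nz)
    \<comment> \<open>The free rows are those of the normalized matrix and the selected rows keep
      the block \<open>?w\<close>, so \<open>rescale\<close> recovers \<open>u\<close>.\<close>
    define x' where "x' = (\<chi> a. if a \<in> free_rows then (x ** w') $ a else x $ a)"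
    have top: "top_block x' = ?w" by (simp add: top_block_def x'_def)
    have "(x ** w') $ \<iota> j = axis j 1" for j
    proof -
      have "(x ** w') $ \<iota> j = (?w ** w') $ j"
        by (simp add: matrix_matrix_mult_def top_block_def vec_eq_iff)
      then show ?thesis by (simp add: w' mat_def axis_def vec_eq_iff)
    qed
    then have norm: "normal x' = x ** w'"
      using inj not_free_iff by (auto simp: normal_def x'_def vec_eq_iff)
    have "rescale (x', y ** w') = u"
      by (simp add: rescale_def top norm xy matrix_mul_assoc [symmetric] w')
    then have "(x', y ** w') \<notin> N" using u by blast
    from good [OF this] have "approx_exponent (x ** w') (y ** w') = ?E"
      by (simp add: norm)
    then show ?thesis using approx_exponent_mult [OF w'(2), of x y] xy by simp
  qed
  then show ?thesis by (intro AE_I' [OF null] subsetI) blast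
qed

end

theorem theorem1p5:
  assumes "CARD('n::finite) \<ge> 2"
    and "1 \<le> CARD('p::finite)" and "CARD('p) \<le> CARD('n) - 1"
  shows "AE (x, y) in (lebesgue :: ((real ^ 'p ^ 'n) \<times> (real ^ 'p ^ 'n)) measure).
           approx_exponent x y = ereal ((real CARD('n) - real CARD('p)) / real CARD('p))"
proof -
  have less: "CARD('p) < CARD('n)" using assms by linarith
  then obtain \<iota> :: "'p \<Rightarrow> 'n" where "inj \<iota>"
    using card_le_inj [of "UNIV :: 'p set" "UNIV :: 'n set"] by auto
  then interpret row_selection \<iota> using less by unfold_locales
  show ?thesis using AE_approx_exponent by (simp add: case_prod_unfold)
qed

end
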